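(* Let $(X,d,\mu)$ be a metric measure space. Let $p,s\in\mathcal{P}_b(X)$ and $q\in\mathcal{P}(X)$. Then the following statements are equivalent. (i) We have the compact embedding $$M^{s(\cdot)}_{p(\cdot),q(\cdot)}(X,d,\mu)\hookrightarrow\hookrightarrow L^{p(\cdot)}(X,\mu).$$ (ii) For every $r\in\mathcal{P}(X)$ and $t\in\mathcal{P}_b(X)$ such that $t\ll s$ we have the compact embeddings $$M^{s(\cdot)}_{p(\cdot),q(\cdot)}(X,d,\mu)\hookrightarrow\hookrightarrow M^{t(\cdot)}_{p(\cdot),r(\cdot)}(X,d,\mu),\qquad M^{s(\cdot)}_{p(\cdot),q(\cdot)}(X,d,\mu)\hookrightarrow\hookrightarrow N^{t(\cdot)}_{p(\cdot),r(\cdot)}(X,d,\mu).$$ (iii) There exist $r\in\mathcal{P}(X)$ and $t\in\mathcal{P}_b(X)$ such that $t\ll s$ and we have at least one of the following compact embeddings: $$M^{s(\cdot)}_{p(\cdot),q(\cdot)}(X,d,\mu)\hookrightarrow\hookrightarrow M^{t(\cdot)}_{p(\cdot),r(\cdot)}(X,d,\mu),\qquad M^{s(\cdot)}_{p(\cdot),q(\cdot)}(X,d,\mu)\hookrightarrow\hookrightarrow N^{t(\cdot)}_{p(\cdot),r(\cdot)}(X,d,\mu).$$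
   Context: A metric measure space $(X,d,\mu)$ is a metric space $(X,d)$ with a Borel measure $\mu$ such that $0<\mu(B(x,r))<\infty$ for every open ball $B(x,r)$, $x\in X$, $r\in(0,\infty)$ (in particular $X$ is separable). Exponents: for measurable $p$ on $X$, $p^+=\operatorname{ess\,sup}_X p$, $p^-=\operatorname{ess\,inf}_X p$. $\mathcal{P}(X)$ is the set of measurable $p:X\to(0,\infty]$ with $p^->0$; $\mathcal{P}_b(X)=\mathcal{P}(X)\cap L^\infty(X,\mu)$. $p_1\ll p_2$ means $(p_2-p_1)^->0$. Lebesgue spaces: for $p\in\mathcal{P}_b(X)$ let $\rho_{p(\cdot)}(u)=\int_X|u(x)|^{p(x)}\,d\mu(x)$. $L^{p(\cdot)}(X,\mu)$ is the space of measurable $u$ with $\rho_{p(\cdot)}(\lambda u)<\infty$ for some $\lambda>0$, with quasi-norm $\|u\|_{L^{p(\cdot)}}=\inf\{\lambda>0:\rho_{p(\cdot)}(u/\lambda)\le1\}$. Mixed spaces ($p\in\mathcal{P}_b(X)$, $q\in\mathcal{P}(X)$): for sequences $\{u_k\}_{k\in\mathbb{Z}}$ of measurable functions, $\|\{u_k\}\|_{L^{p(\cdot)}(\ell^{q(\cdot)})}=\big\|\,\|\{u_k(\cdot)\}_k\|_{\ell^{q(\cdot)}}\big\|_{L^{p(\cdot)}}$ (pointwise $\ell^{q(x)}(\mathbb{Z})$ quasi-norm, supremum if $q(x)=\infty$). Let $\rho_{\ell^{q(\cdot)}(L^{p(\cdot)})}(\{u_k\})=\sum_{k\in\mathbb{Z}}\inf\{\lambda_k>0:\rho_{p(\cdot)}(u_k/\lambda_k^{1/q(\cdot)})\le1\}$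 (with $\lambda^{1/\infty}=1$) and $\|\{u_k\}\|_{\ell^{q(\cdot)}(L^{p(\cdot)})}=\inf\{m>0:\rho_{\ell^{q(\cdot)}(L^{p(\cdot)})}(\{u_k\}/m)\le1\}$. Gradients: let $s\in\mathcal{P}_b(X)$ and $u:X\to\overline{\mathbb{R}}$ be measurable and finite a.e. A sequence $\{g_k\}_{k\in\mathbb{Z}}$ of non-negative measurable functions is a vector $s(\cdot)$-gradient of $u$ (written $\{g_k\}\in\mathbb{D}^{s(\cdot)}(u)$) if there is a $\mu$-null set $N_u$ such that $|u(x)-u(y)|\le d(x,y)^{s(x)}g_k(x)+d(x,y)^{s(y)}g_k(y)$ for all $k\in\mathbb{Z}$ and all $x,y\in X\setminus N_u$ with $2^{-k-1}\le d(x,y)<2^{-k}$. Function spaces: $\|u\|_{\dot M^{s(\cdot)}_{p(\cdot),q(\cdot)}}=\inf_{g\in\mathbb{D}^{s(\cdot)}(u)}\|g\|_{L^{p(\cdot)}(\ell^{q(\cdot)})}$ and $\|u\|_{\dot N^{s(\cdot)}_{p(\cdot),q(\cdot)}}=\inf_{g\in\mathbb{D}^{s(\cdot)}(u)}\|g\|_{\ell^{q(\cdot)}(L^{p(\cdot)})}$. For $A\in\{M,N\}$, $A^{s(\cdot)}_{p(\cdot),q(\cdot)}(X,d,\mu)$ is the space of $u\in L^{p(\cdot)}(X,\mu)$ with $\|u\|_{\dot A^{s(\cdot)}_{p(\cdot),q(\cdot)}}<\infty$, with quasi-norm $\|u\|_{L^{p(\cdot)}}+\|u\|_{\dot A^{s(\cdot)}_{p(\cdot),q(\cdot)}}$.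 $Y\hookrightarrow\hookrightarrow Z$ (compact embedding) means $Y\subseteq Z$ with continuous inclusion mapping bounded subsets of $Y$ to totally bounded subsets of $Z$. *)

theory Defs
  imports "HOL-Analysis.Analysis" "HOL-Probability.Essential_Supremum"
begin

definition metric_measure_space :: "'a::metric_space measure \<Rightarrow> bool" where
  "metric_measure_space \<mu> \<longleftrightarrow> sets \<mu> = sets borel \<and>
     (\<forall>x r. 0 < r \<longrightarrow> 0 < emeasure \<mu> (ball x r) \<and> emeasure \<mu> (ball x r) < \<infinity>)"

definition essinf :: "'a measure \<Rightarrow> ('a \<Rightarrow> ereal) \<Rightarrow> ereal" where
  "essinf \<mu> f = Sup {z. AE x in \<mu>. z \<le> f x}"

definition exponents :: "'a measure \<Rightarrow> ('a \<Rightarrow> ereal) set" where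
  "exponents \<mu> = {p \<in> borel_measurable \<mu>. (\<forall>x\<in>space \<mu>. 0 < p x) \<and> 0 < essinf \<mu> p}"

definition bdd_exponents :: "'a measure \<Rightarrow> ('a \<Rightarrow> ereal) set" where
  "bdd_exponents \<mu> = {p \<in> exponents \<mu>. esssup \<mu> p < \<infinity>}"

definition exponent_ll :: "'a measure \<Rightarrow> ('a \<Rightarrow> ereal) \<Rightarrow> ('a \<Rightarrow> ereal) \<Rightarrow> bool" where
  "exponent_ll \<mu> p1 p2 \<longleftrightarrow> 0 < essinf \<mu> (\<lambda>x. p2 x - p1 x)"

text \<open>The power \<open>a\<^sup>p\<close> for an exponent \<open>0 < p < \<infinity>\<close>. A bounded exponent may be infinite on a
  null set; there the value is irrelevant, because it only enters through an integral or an
  almost-everywhere condition.\<close>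

definition epowr :: "ennreal \<Rightarrow> ereal \<Rightarrow> ennreal" where
  "epowr a p = (if a = \<infinity> then \<infinity> else ennreal (enn2real a powr real_of_ereal p))"

definition Lp_modular :: "'a measure \<Rightarrow> ('a \<Rightarrow> ereal) \<Rightarrow> ('a \<Rightarrow> ereal) \<Rightarrow> ennreal" where
  "Lp_modular \<mu> p u = (\<integral>\<^sup>+x. epowr (e2ennreal \<bar>u x\<bar>) (p x) \<partial>\<mu>)"

definition Lp_norm :: "'a measure \<Rightarrow> ('a \<Rightarrow> ereal) \<Rightarrow> ('a \<Rightarrow> ereal) \<Rightarrow> ennreal" where
  "Lp_norm \<mu> p u = (INF l\<in>{l::real. 0 < l \<and> Lp_modular \<mu> p (\<lambda>x. u x / ereal l) \<le> 1}. ennreal l)"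

definition Lp_space :: "'a measure \<Rightarrow> ('a \<Rightarrow> ereal) \<Rightarrow> ('a \<Rightarrow> ereal) set" where
  "Lp_space \<mu> p =
     {u \<in> borel_measurable \<mu>. \<exists>l::real. 0 < l \<and> Lp_modular \<mu> p (\<lambda>x. ereal l * u x) < \<infinity>}"

definition lq_norm :: "ereal \<Rightarrow> (int \<Rightarrow> ereal) \<Rightarrow> ennreal" where
  "lq_norm q a =
     (if q = \<infinity> then (SUP k. e2ennreal \<bar>a k\<bar>)
      else epowr (\<Sum>\<^sub>\<infinity>k. epowr (e2ennreal \<bar>a k\<bar>) q) (1 / q))"

definition Lp_lq_norm ::
  "'a measure \<Rightarrow> ('a \<Rightarrow> ereal) \<Rightarrow> ('a \<Rightarrow> ereal) \<Rightarrow> (int \<Rightarrow> 'a \<Rightarrow> ereal) \<Rightarrow> ennreal" where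
  "Lp_lq_norm \<mu> p q u = Lp_norm \<mu> p (\<lambda>x. enn2ereal (lq_norm (q x) (\<lambda>k. u k x)))"

text \<open>In \<^typ>\<open>ereal\<close> we have \<open>1 / \<infinity> = 0\<close>, so \<open>l\<^sup>1\<^sup>/\<^sup>q = 1\<close> where \<open>q = \<infinity>\<close>, as required.\<close>

definition lq_Lp_modular ::
  "'a measure \<Rightarrow> ('a \<Rightarrow> ereal) \<Rightarrow> ('a \<Rightarrow> ereal) \<Rightarrow> (int \<Rightarrow> 'a \<Rightarrow> ereal) \<Rightarrow> ennreal" where
  "lq_Lp_modular \<mu> p q u =
     (\<Sum>\<^sub>\<infinity>k. INF l\<in>{l::real. 0 < l \<and>
        Lp_modular \<mu> p (\<lambda>x. u k x / ereal (l powr real_of_ereal (1 / q x))) \<le> 1}. ennreal l)"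

definition lq_Lp_norm ::
  "'a measure \<Rightarrow> ('a \<Rightarrow> ereal) \<Rightarrow> ('a \<Rightarrow> ereal) \<Rightarrow> (int \<Rightarrow> 'a \<Rightarrow> ereal) \<Rightarrow> ennreal" where
  "lq_Lp_norm \<mu> p q u =
     (INF m\<in>{m::real. 0 < m \<and> lq_Lp_modular \<mu> p q (\<lambda>k x. u k x / ereal m) \<le> 1}. ennreal m)"

text \<open>Only used for \<open>u\<close> finite almost everywhere, so that the null set \<open>N\<close> may be taken to
  contain all points where \<open>u\<close> or \<open>s\<close> is infinite.\<close>

definition vector_gradients ::
  "'a::metric_space measure \<Rightarrow> ('a \<Rightarrow> ereal) \<Rightarrow> ('a \<Rightarrow> ereal) \<Rightarrow> (int \<Rightarrow> 'a \<Rightarrow> ereal) set" where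
  "vector_gradients \<mu> s u =
     {g. (\<forall>k. g k \<in> borel_measurable \<mu> \<and> (\<forall>x. 0 \<le> g k x)) \<and>
         (\<exists>N\<in>null_sets \<mu>. \<forall>k. \<forall>x\<in>-N. \<forall>y\<in>-N.
            2 powi (- k - 1) \<le> dist x y \<and> dist x y < 2 powi (- k) \<longrightarrow>
            \<bar>u x - u y\<bar> \<le> ereal (dist x y powr real_of_ereal (s x)) * g k x
                         + ereal (dist x y powr real_of_ereal (s y)) * g k y)}"

definition M_seminorm ::
  "'a::metric_space measure \<Rightarrow> ('a \<Rightarrow> ereal) \<Rightarrow> ('a \<Rightarrow> ereal) \<Rightarrow> ('a \<Rightarrow> ereal) \<Rightarrow>
   ('a \<Rightarrow> ereal) \<Rightarrow> ennreal" where
  "M_seminorm \<mu> s p q u = (INF g\<in>vector_gradients \<mu> s u. Lp_lq_norm \<mu> p q g)"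

definition N_seminorm ::
  "'a::metric_space measure \<Rightarrow> ('a \<Rightarrow> ereal) \<Rightarrow> ('a \<Rightarrow> ereal) \<Rightarrow> ('a \<Rightarrow> ereal) \<Rightarrow>
   ('a \<Rightarrow> ereal) \<Rightarrow> ennreal" where
  "N_seminorm \<mu> s p q u = (INF g\<in>vector_gradients \<mu> s u. lq_Lp_norm \<mu> p q g)"

definition M_space ::
  "'a::metric_space measure \<Rightarrow> ('a \<Rightarrow> ereal) \<Rightarrow> ('a \<Rightarrow> ereal) \<Rightarrow> ('a \<Rightarrow> ereal) \<Rightarrow>
   ('a \<Rightarrow> ereal) set" where
  "M_space \<mu> s p q = {u \<in> Lp_space \<mu> p. M_seminorm \<mu> s p q u < \<infinity>}"

definition N_space ::
  "'a::metric_space measure \<Rightarrow> ('a \<Rightarrow> ereal) \<Rightarrow> ('a \<Rightarrow> ereal) \<Rightarrow> ('a \<Rightarrow> ereal) \<Rightarrow>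
   ('a \<Rightarrow> ereal) set" where
  "N_space \<mu> s p q = {u \<in> Lp_space \<mu> p. N_seminorm \<mu> s p q u < \<infinity>}"

definition M_norm ::
  "'a::metric_space measure \<Rightarrow> ('a \<Rightarrow> ereal) \<Rightarrow> ('a \<Rightarrow> ereal) \<Rightarrow> ('a \<Rightarrow> ereal) \<Rightarrow>
   ('a \<Rightarrow> ereal) \<Rightarrow> ennreal" where
  "M_norm \<mu> s p q u = Lp_norm \<mu> p u + M_seminorm \<mu> s p q u"

definition N_norm ::
  "'a::metric_space measure \<Rightarrow> ('a \<Rightarrow> ereal) \<Rightarrow> ('a \<Rightarrow> ereal) \<Rightarrow> ('a \<Rightarrow> ereal) \<Rightarrow>
   ('a \<Rightarrow> ereal) \<Rightarrow> ennreal" where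
  "N_norm \<mu> s p q u = Lp_norm \<mu> p u + N_seminorm \<mu> s p q u"

text \<open>A space is given by its set of functions and its quasi-norm; functions are not identified
  almost everywhere, which changes neither the quasi-norms nor any of the notions below. The
  difference of two almost everywhere finite functions is taken pointwise in \<^typ>\<open>ereal\<close>.\<close>

definition continuous_inclusion ::
  "('a \<Rightarrow> ereal) set \<Rightarrow> (('a \<Rightarrow> ereal) \<Rightarrow> ennreal) \<Rightarrow> (('a \<Rightarrow> ereal) \<Rightarrow> ennreal) \<Rightarrow> bool" where
  "continuous_inclusion Y nY nZ \<longleftrightarrow>
     (\<forall>u\<in>Y. \<forall>e>0. \<exists>d>0. \<forall>v\<in>Y. nY (\<lambda>x. v x - u x) < d \<longrightarrow> nZ (\<lambda>x. v x - u x) < e)"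

definition norm_bounded ::
  "(('a \<Rightarrow> ereal) \<Rightarrow> ennreal) \<Rightarrow> ('a \<Rightarrow> ereal) set \<Rightarrow> bool" where
  "norm_bounded nY S \<longleftrightarrow> (\<exists>C<\<infinity>. \<forall>u\<in>S. nY u \<le> C)"

definition norm_totally_bounded ::
  "('a \<Rightarrow> ereal) set \<Rightarrow> (('a \<Rightarrow> ereal) \<Rightarrow> ennreal) \<Rightarrow> ('a \<Rightarrow> ereal) set \<Rightarrow> bool" where
  "norm_totally_bounded Z nZ S \<longleftrightarrow> S \<subseteq> Z \<and>
     (\<forall>e>0. \<exists>F. finite F \<and> F \<subseteq> Z \<and> (\<forall>u\<in>S. \<exists>v\<in>F. nZ (\<lambda>x. u x - v x) < e))"

definition compact_embedding ::
  "('a \<Rightarrow> ereal) set \<Rightarrow> (('a \<Rightarrow> ereal) \<Rightarrow> ennreal) \<Rightarrow>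
   ('a \<Rightarrow> ereal) set \<Rightarrow> (('a \<Rightarrow> ereal) \<Rightarrow> ennreal) \<Rightarrow> bool" where
  "compact_embedding Y nY Z nZ \<longleftrightarrow> Y \<subseteq> Z \<and> continuous_inclusion Y nY nZ \<and>
     (\<forall>S\<subseteq>Y. norm_bounded nY S \<longrightarrow> norm_totally_bounded Z nZ S)"

end

theory Submission
  imports Defs
begin

text \<open>
  Only one implication has content. The target norms in (ii) and (iii) contain the \<open>L\<^sup>p\<close>-norm as
  a summand, so (iii) implies (i) (\<open>compact_embedding_weaken_target\<close>), and (ii) implies (iii)
  because \<open>t = s / 2\<close> and \<open>r = q\<close> are admissible (\<open>halved_exponent\<close>).

  For (i) to (ii), the idea is an interpolation inequality (\<open>ehrling_inequality\<close>): if \<open>t \<lless> s\<close>,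
  then for each \<open>e > 0\<close> there is \<open>A\<close> such that both the \<open>M\<close>- and the \<open>N\<close>-seminorm of
  smoothness \<open>t\<close> of every \<open>w\<close> are at most \<open>A\<close> times its \<open>L\<^sup>p\<close>-norm plus \<open>e\<close> times its
  \<open>M\<close>-seminorm of smoothness \<open>s\<close>. Applied to differences \<open>w = u - v\<close> of elements of a bounded
  set, where the last term is uniformly small, it turns an \<open>L\<^sup>p\<close>-net into a net for the
  stronger quasi-norm (\<open>compact_embedding_by_ehrling\<close>); continuity of the inclusion also follows from it.

  The inequality comes from an explicit gradient (\<open>vector_gradient_lower_smoothness\<close>). Let \<open>g\<close> be
  an \<open>s\<close>-gradient of \<open>w\<close> and let \<open>\<delta> > 0\<close> be a lower bound of \<open>s - t\<close>. On small scales,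
  \<open>k \<ge> K\<close>, the functions \<open>2\<^sup>-\<^sup>\<delta>\<^sup>k g\<^sub>k\<close> serve as a \<open>t\<close>-gradient, with a factor that is
  small for large \<open>K\<close>. On the scales \<open>k < K\<close> one uses \<open>c\<^sub>k \<bar>w\<bar>\<close> with constants \<open>c\<^sub>k\<close> that
  decay geometrically as \<open>k\<close> tends to \<open>-\<infinity>\<close>, since \<open>t\<close> is bounded away from \<open>0\<close>. The
  geometric decay in both directions makes the inner exponent \<open>r\<close> immaterial, and also the order in
  which the \<open>\<ell>\<^sup>r\<close>- and \<open>L\<^sup>p\<close>-norms are taken (\<open>mixed_norms_le\<close>). On the source side,
  \<open>q\<close> is replaced by \<open>\<infinity>\<close> (\<open>M_seminorm_infinity_le\<close>).

  The exponent \<open>p\<close> may be smaller than \<open>1\<close>. Instead of a triangle inequality for the modular, all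
  estimates use that a function bounded by \<open>2\<^sup>-\<^sup>1\<^sup>/\<^sup>l\<close> times the maximum of two elements of its
  unit ball again lies in the unit ball, where \<open>l > 0\<close> is a lower bound of \<open>p\<close>
  (\<open>Lp_modular_shrink_max\<close>).
\<close>

section \<open>Powers and absolute values in the extended half-line\<close>

abbreviation eabs :: "ereal \<Rightarrow> ennreal" where
  "eabs x \<equiv> e2ennreal \<bar>x\<bar>"

lemma eabs_enn2ereal [simp]: "eabs (enn2ereal y) = y"
  by simp

lemma eabs_mult: "0 \<le> c \<Longrightarrow> eabs (ereal c * x) = ennreal c * eabs x"
proof -
  have "e2ennreal 0 = 0"
    using e2ennreal_ereal[of 0] by (metis ennreal_0 zero_ereal_def)
  then show "0 \<le> c \<Longrightarrow> eabs (ereal c * x) = ennreal c * eabs x"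
    by (cases x) (auto simp: abs_mult ennreal_mult e2ennreal_ereal ennreal_mult_top)
qed

lemma eabs_divide: "0 < c \<Longrightarrow> eabs (x / ereal c) = ennreal (inverse c) * eabs x"
  using eabs_mult[of "inverse c" x] by (simp add: divide_ereal_def mult.commute)

lemma eabs_rescale: "0 < c \<Longrightarrow> eabs x = ennreal c * eabs (x / ereal c)"
  by (simp add: eabs_divide mult.assoc[symmetric] ennreal_mult[symmetric])

lemma eabs_add: "eabs (x + y) \<le> eabs x + eabs y"
  by (cases x; cases y) (auto simp: ennreal_plus[symmetric] simp del: ennreal_plus intro!: ennreal_leI)

lemma eabs_diff: "eabs (x - y) \<le> eabs (x - z) + eabs (y - z)"
  by (cases x; cases y; cases z)
    (auto simp: ennreal_plus[symmetric] simp del: ennreal_plus intro!: ennreal_leI)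

lemma ennreal_mult3:
  "0 \<le> x \<Longrightarrow> 0 \<le> y \<Longrightarrow> 0 \<le> z \<Longrightarrow>
    ennreal x * (ennreal y * (ennreal z * m)) = ennreal (x * y * z) * m"
  by (simp add: ennreal_mult mult.assoc)

lemma add_le_double_max: "(x::ennreal) + y \<le> ennreal 2 * max x y"
proof -
  have "x + y \<le> max x y + max x y" by (intro add_mono) auto
  also have "\<dots> = ennreal 2 * max x y" by (simp add: mult_2)
  finally show ?thesis .
qed

lemma epowr_mono: "a \<le> b \<Longrightarrow> 0 \<le> p \<Longrightarrow> epowr a (ereal p) \<le> epowr b (ereal p)"
  by (cases a; cases b)
    (auto simp: epowr_def top_unique intro!: ennreal_leI powr_mono2)

lemma epowr_cmult:
  "0 < c \<Longrightarrow> epowr (ennreal c * a) (ereal p) = ennreal (c powr p) * epowr a (ereal p)"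
  by (cases a)
    (auto simp: epowr_def ennreal_mult_top ennreal_mult[symmetric] powr_mult ennreal_mult_eq_top_iff)

lemma epowr_root: "0 < p \<Longrightarrow> epowr (epowr a (ereal p)) (1 / ereal p) = a"
  by (cases a) (auto simp: epowr_def powr_powr one_ereal_def)

lemma measurable_epowr [measurable]:
  assumes [measurable]: "u \<in> borel_measurable M" "p \<in> borel_measurable M"
  shows "(\<lambda>x. epowr (eabs (u x)) (p x)) \<in> borel_measurable M"
  unfolding epowr_def by measurable

section \<open>Exponents\<close>

lemma essinf_posE:
  assumes "0 < essinf \<mu> f"
  obtains c :: real where "0 < c" "AE x in \<mu>. ereal c \<le> f x"
proof -
  obtain z where z: "0 < z" "AE x in \<mu>. z \<le> f x"
    using assms by (auto simp: essinf_def less_Sup_iff)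
  obtain c where c: "0 < ereal c" "ereal c < z"
    using ereal_dense2[OF z(1)] by blast
  have "AE x in \<mu>. ereal c \<le> f x"
    using z(2) by eventually_elim (use c in auto)
  with c show ?thesis by (intro that[of c]) auto
qed

lemma essinf_posI: "0 < c \<Longrightarrow> AE x in \<mu>. ereal c \<le> f x \<Longrightarrow> 0 < essinf \<mu> f"
  unfolding essinf_def less_Sup_iff by (rule bexI[of _ "ereal c"]) auto

lemma bdd_exponent_bounds:
  assumes "p \<in> bdd_exponents \<mu>"
  obtains l h :: real where "0 < l" "l \<le> h" "AE x in \<mu>. ereal l \<le> p x \<and> p x \<le> ereal h"
proof -
  have meas: "p \<in> borel_measurable \<mu>" and inf: "0 < essinf \<mu> p" and sup: "esssup \<mu> p < \<infinity>"
    using assms by (auto simp: bdd_exponents_def exponents_def)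
  obtain l where l: "0 < l" "AE x in \<mu>. ereal l \<le> p x"
    using essinf_posE[OF inf] .
  obtain h where h: "esssup \<mu> p \<le> ereal h"
    using sup by (cases "esssup \<mu> p") auto
  have "AE x in \<mu>. p x \<le> ereal (max l h)"
    using esssup_AE[of p \<mu>]
  proof eventually_elim
    case (elim x)
    also note h
    also have "ereal h \<le> ereal (max l h)" by simp
    finally show ?case .
  qed
  with l(2) show ?thesis
    by (intro that[of l "max l h"]) (use l in auto)
qed

lemma halved_exponent:
  assumes s: "s \<in> bdd_exponents \<mu>"
  defines "t \<equiv> \<lambda>x. s x / ereal 2"
  shows "t \<in> bdd_exponents \<mu>" "exponent_ll \<mu> t s"
proof -
  obtain l h where l: "0 < l" and lh: "AE x in \<mu>. ereal l \<le> s x \<and> s x \<le> ereal h"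
    using bdd_exponent_bounds[OF s] .
  have [measurable]: "s \<in> borel_measurable \<mu>" and pos: "\<forall>x\<in>space \<mu>. 0 < s x"
    using s by (auto simp: bdd_exponents_def exponents_def)
  have t_meas: "t \<in> borel_measurable \<mu>" unfolding t_def by measurable
  have t_pos: "0 < t x" if "x \<in> space \<mu>" for x
    using pos that by (cases "s x") (auto simp: t_def)
  have bounds: "AE x in \<mu>. ereal (l / 2) \<le> t x \<and> t x \<le> ereal (h / 2) \<and> ereal (l / 2) \<le> s x - t x"
    using lh
  proof eventually_elim
    case (elim x)
    then show ?case by (cases "s x") (auto simp: t_def)
  qed
  have "0 < essinf \<mu> t"
    using bounds l by (intro essinf_posI[of "l / 2"]) auto
  moreover have "esssup \<mu> t \<le> ereal (h / 2)"
    using bounds t_meas by (intro esssup_I) auto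
  then have "esssup \<mu> t < \<infinity>" by (rule order.strict_trans1) simp
  ultimately show "t \<in> bdd_exponents \<mu>"
    using t_meas t_pos by (auto simp: bdd_exponents_def exponents_def)
  show "exponent_ll \<mu> t s"
    unfolding exponent_ll_def using bounds l by (intro essinf_posI[of "l / 2"]) auto
qed

section \<open>Modulars and norms\<close>

text \<open>The lower bound \<open>l\<close> is a parameter because the constants \<open>shrink l\<close> and \<open>quasi_const l\<close>
  below depend on it.\<close>

definition bounded_below_exponent :: "'a measure \<Rightarrow> real \<Rightarrow> ('a \<Rightarrow> ereal) \<Rightarrow> bool" where
  "bounded_below_exponent \<mu> l p \<longleftrightarrow>
     p \<in> borel_measurable \<mu> \<and> 0 < l \<and> (AE x in \<mu>. ereal l \<le> p x \<and> p x < \<infinity>)"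

lemma bdd_exponent_bounded_below:
  assumes "p \<in> bdd_exponents \<mu>"
  obtains l where "bounded_below_exponent \<mu> l p"
proof -
  obtain l h where "0 < l" "AE x in \<mu>. ereal l \<le> p x \<and> p x \<le> ereal h"
    using bdd_exponent_bounds[OF assms] by blast
  moreover from this(2) have "AE x in \<mu>. ereal l \<le> p x \<and> p x < \<infinity>"
    by eventually_elim auto
  ultimately show ?thesis
    using assms that by (auto simp: bounded_below_exponent_def bdd_exponents_def exponents_def)
qed

text \<open>For \<open>\<kappa> = 2\<^sup>-\<^sup>1\<^sup>/\<^sup>l\<close> and \<open>p \<ge> l\<close> we have \<open>\<kappa>\<^sup>p \<le> 1/2\<close>, so that
  \<open>(\<kappa> max(f,g))\<^sup>p \<le> (f\<^sup>p + g\<^sup>p) / 2\<close>. In this form the unit ball of the modular is stable under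
  maxima up to the constant \<open>\<kappa>\<close>; it takes the place of the triangle inequality.\<close>

definition shrink :: "real \<Rightarrow> real" where
  "shrink l = 2 powr (- 1 / l)"

lemma shrink_pos: "0 < shrink l"
  by (simp add: shrink_def)

lemma epowr_shrink_max:
  assumes "0 < l" "ereal l \<le> p" "p < \<infinity>" "a \<le> ennreal (shrink l) * max b c"
  shows "epowr a p \<le> ennreal (1/2) * (epowr b p + epowr c p)"
proof -
  obtain p' where p: "p = ereal p'" "l \<le> p'"
    using assms by (cases p) auto
  have "shrink l powr p' \<le> 1/2"
  proof -
    have "shrink l powr p' = 2 powr (- (p' / l))"
      by (simp add: shrink_def powr_powr)
    also have "\<dots> \<le> 2 powr (- 1)"
      using p assms by (intro powr_mono) auto
    finally show ?thesis by (simp add: powr_minus)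
  qed
  moreover have "epowr (max b c) p \<le> epowr b p + epowr c p"
    by (auto simp: max_def)
  moreover have "epowr a p \<le> ennreal (shrink l powr p') * epowr (max b c) p"
    using epowr_mono[OF assms(4), of p'] p assms epowr_cmult[OF shrink_pos] by simp
  ultimately show ?thesis
    by (meson ennreal_leI mult_mono order_trans zero_le)
qed

lemma Lp_modular_shrink_max:
  assumes p: "bounded_below_exponent \<mu> l p"
    and [measurable]: "f \<in> borel_measurable \<mu>" "g \<in> borel_measurable \<mu>"
    and le1: "Lp_modular \<mu> p f \<le> 1" "Lp_modular \<mu> p g \<le> 1"
    and h: "AE x in \<mu>. eabs (h x) \<le> ennreal (shrink l) * max (eabs (f x)) (eabs (g x))"
  shows "Lp_modular \<mu> p h \<le> 1"
proof -
  have [measurable]: "p \<in> borel_measurable \<mu>" and "0 < l"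
    and pl: "AE x in \<mu>. ereal l \<le> p x \<and> p x < \<infinity>"
    using p by (auto simp: bounded_below_exponent_def)
  have "Lp_modular \<mu> p h
      \<le> (\<integral>\<^sup>+x. ennreal (1/2) * (epowr (eabs (f x)) (p x) + epowr (eabs (g x)) (p x)) \<partial>\<mu>)"
    unfolding Lp_modular_def
  proof (rule nn_integral_mono_AE)
    show "AE x in \<mu>. epowr (eabs (h x)) (p x)
        \<le> ennreal (1/2) * (epowr (eabs (f x)) (p x) + epowr (eabs (g x)) (p x))"
      using pl h by eventually_elim (use \<open>0 < l\<close> in \<open>blast intro: epowr_shrink_max\<close>)
  qed
  also have "\<dots> = ennreal (1/2) * (Lp_modular \<mu> p f + Lp_modular \<mu> p g)"
    by (simp add: nn_integral_cmult nn_integral_add Lp_modular_def)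
  also have "\<dots> \<le> ennreal (1/2) * (ennreal 1 + ennreal 1)"
    using le1 by (intro mult_left_mono add_mono) auto
  also have "\<dots> = ennreal (1/2) * ennreal (1 + 1)"
    by (subst ennreal_plus) auto
  also have "\<dots> = ennreal (1/2 * (1 + 1))"
    by (rule ennreal_mult[symmetric]) auto
  also have "\<dots> = 1"
    by simp
  finally show ?thesis .
qed

lemma Lp_modular_mono:
  assumes "bounded_below_exponent \<mu> l p" "\<And>x. eabs (f x) \<le> eabs (g x)"
  shows "Lp_modular \<mu> p f \<le> Lp_modular \<mu> p g"
  unfolding Lp_modular_def
proof (rule nn_integral_mono_AE)
  have "0 < l" "AE x in \<mu>. ereal l \<le> p x \<and> p x < \<infinity>"
    using assms by (auto simp: bounded_below_exponent_def)
  from this(2) show "AE x in \<mu>. epowr (eabs (f x)) (p x) \<le> epowr (eabs (g x)) (p x)"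
  proof eventually_elim
    case (elim x)
    then obtain p' where "p x = ereal p'" "l \<le> p'" by (cases "p x") auto
    then show ?case using epowr_mono[OF assms(2)] \<open>0 < l\<close> by simp
  qed
qed

lemma Lp_norm_leI: "0 < a \<Longrightarrow> Lp_modular \<mu> p (\<lambda>x. u x / ereal a) \<le> 1 \<Longrightarrow> Lp_norm \<mu> p u \<le> ennreal a"
  unfolding Lp_norm_def by (rule INF_lower) auto

lemma Lp_norm_lessD:
  assumes "bounded_below_exponent \<mu> l p" "Lp_norm \<mu> p u < ennreal a" "0 < a"
  shows "Lp_modular \<mu> p (\<lambda>x. u x / ereal a) \<le> 1"
proof -
  obtain b where b: "0 < b" "Lp_modular \<mu> p (\<lambda>x. u x / ereal b) \<le> 1" "b < a"
    using assms(2,3) by (auto simp: Lp_norm_def INF_less_iff ennreal_less_iff)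
  have "Lp_modular \<mu> p (\<lambda>x. u x / ereal a) \<le> Lp_modular \<mu> p (\<lambda>x. u x / ereal b)"
    using assms(1) by (rule Lp_modular_mono)
      (use b assms(3) in \<open>auto simp: eabs_divide intro!: mult_right_mono ennreal_leI\<close>)
  with b(2) show ?thesis by (rule order_trans[rotated])
qed

lemma Lp_norm_mono:
  assumes "bounded_below_exponent \<mu> l p" "\<And>x. eabs (f x) \<le> eabs (g x)"
  shows "Lp_norm \<mu> p f \<le> Lp_norm \<mu> p g"
  unfolding Lp_norm_def
proof (rule INF_superset_mono[OF _ order_refl], safe)
  fix a :: real assume "0 < a" "Lp_modular \<mu> p (\<lambda>x. g x / ereal a) \<le> 1"
  moreover have "Lp_modular \<mu> p (\<lambda>x. f x / ereal a) \<le> Lp_modular \<mu> p (\<lambda>x. g x / ereal a)"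
    using assms(1) by (rule Lp_modular_mono)
      (use \<open>0 < a\<close> in \<open>auto simp: eabs_divide intro!: mult_left_mono assms(2)\<close>)
  ultimately show "Lp_modular \<mu> p (\<lambda>x. f x / ereal a) \<le> 1" by simp
qed

definition quasi_const :: "real \<Rightarrow> real" where
  "quasi_const l = 2 / shrink l"

lemma quasi_const_pos: "0 < quasi_const l"
  by (simp add: quasi_const_def shrink_pos)

text \<open>The factor \<open>2\<close> in \<open>quasi_const\<close> comes from \<open>x + y \<le> 2 max(x, y)\<close>; the remaining
  \<open>1 / shrink l\<close> returns the maximum to the unit ball.\<close>

lemma Lp_norm_quasi_triangle:
  assumes p: "bounded_below_exponent \<mu> l p"
    and [measurable]: "f \<in> borel_measurable \<mu>" "g \<in> borel_measurable \<mu>"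
    and a: "0 < a" "Lp_norm \<mu> p f < ennreal a" "Lp_norm \<mu> p g < ennreal a"
    and h: "\<And>x. eabs (h x) \<le> eabs (f x) + eabs (g x)"
  shows "Lp_norm \<mu> p h \<le> ennreal (quasi_const l * a)"
proof (rule Lp_norm_leI)
  show "0 < quasi_const l * a" using a quasi_const_pos by simp
  show "Lp_modular \<mu> p (\<lambda>x. h x / ereal (quasi_const l * a)) \<le> 1"
  proof (rule Lp_modular_shrink_max[OF p])
    show "AE x in \<mu>. eabs (h x / ereal (quasi_const l * a))
        \<le> ennreal (shrink l) * max (eabs (f x / ereal a)) (eabs (g x / ereal a))"
    proof (rule AE_I2)
      fix x
      let ?m = "max (eabs (f x / ereal a)) (eabs (g x / ereal a))"
      have "eabs (h x) \<le> ennreal a * (eabs (f x / ereal a) + eabs (g x / ereal a))"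
        unfolding distrib_left eabs_rescale[OF a(1), symmetric] by (rule h)
      also have "\<dots> \<le> ennreal a * (ennreal 2 * ?m)"
        by (intro mult_left_mono add_le_double_max) simp
      finally have "eabs (h x / ereal (quasi_const l * a))
          \<le> ennreal (inverse (quasi_const l * a)) * (ennreal a * (ennreal 2 * ?m))"
        using a quasi_const_pos[of l] by (simp add: eabs_divide mult_left_mono)
      also have "\<dots> = ennreal (inverse (quasi_const l * a) * a * 2) * ?m"
        using a quasi_const_pos[of l] by (intro ennreal_mult3) auto
      also have "inverse (quasi_const l * a) * a * 2 = shrink l"
        using a shrink_pos[of l] by (simp add: quasi_const_def field_simps)
      finally show "eabs (h x / ereal (quasi_const l * a)) \<le> ennreal (shrink l) * ?m" .
    qed
  qed (use a p Lp_norm_lessD in auto)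
qed

lemma Lp_norm_finite:
  assumes p: "bounded_below_exponent \<mu> l p" and u: "u \<in> Lp_space \<mu> p"
  shows "Lp_norm \<mu> p u < \<infinity>"
proof -
  obtain c where [measurable]: "u \<in> borel_measurable \<mu>" and c: "0 < c"
    and fin: "Lp_modular \<mu> p (\<lambda>x. ereal c * u x) < \<infinity>"
    using u by (auto simp: Lp_space_def)
  have [measurable]: "p \<in> borel_measurable \<mu>" and "0 < l"
    and pl: "AE x in \<mu>. ereal l \<le> p x \<and> p x < \<infinity>"
    using p by (auto simp: bounded_below_exponent_def)
  obtain m where m: "1 \<le> m" "Lp_modular \<mu> p (\<lambda>x. ereal c * u x) \<le> ennreal m"
  proof -
    obtain m where "Lp_modular \<mu> p (\<lambda>x. ereal c * u x) = ennreal m" "0 \<le> m"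
      using fin by (cases "Lp_modular \<mu> p (\<lambda>x. ereal c * u x)") auto
    then show ?thesis by (intro that[of "max 1 m"]) (auto intro!: ennreal_leI)
  qed
  \<comment> \<open>Shrinking the argument by the factor \<open>m\<^sup>-\<^sup>1\<^sup>/\<^sup>l \<le> 1\<close> shrinks the modular at least by \<open>1/m\<close>.\<close>
  define d where "d = m powr (- 1 / l)"
  have d: "0 < d" using m by (simp add: d_def)
  have "Lp_modular \<mu> p (\<lambda>x. u x / ereal (1 / (d * c)))
      \<le> (\<integral>\<^sup>+x. ennreal (1/m) * epowr (eabs (ereal c * u x)) (p x) \<partial>\<mu>)"
    unfolding Lp_modular_def
  proof (rule nn_integral_mono_AE)
    show "AE x in \<mu>. epowr (eabs (u x / ereal (1 / (d * c)))) (p x)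
        \<le> ennreal (1/m) * epowr (eabs (ereal c * u x)) (p x)"
      using pl
    proof eventually_elim
      case (elim x)
      then obtain p' where p': "p x = ereal p'" "l \<le> p'" by (cases "p x") auto
      have "eabs (u x / ereal (1 / (d * c))) = ennreal d * eabs (ereal c * u x)"
        using c d by (simp add: eabs_divide eabs_mult ennreal_mult mult.assoc)
      then have "epowr (eabs (u x / ereal (1 / (d * c)))) (p x)
          = ennreal (d powr p') * epowr (eabs (ereal c * u x)) (p x)"
        using d p' by (simp add: epowr_cmult)
      moreover have "d powr p' \<le> 1/m"
      proof -
        have "d powr p' = m powr (- (p' / l))" by (simp add: d_def powr_powr)
        also have "\<dots> \<le> m powr (- 1)" using m p' \<open>0 < l\<close> by (intro powr_mono) auto
        finally show ?thesis using m by (simp add: powr_minus_divide)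
      qed
      ultimately show ?case by (simp add: mult_right_mono ennreal_leI)
    qed
  qed
  also have "\<dots> = ennreal (1/m) * Lp_modular \<mu> p (\<lambda>x. ereal c * u x)"
    by (simp add: nn_integral_cmult Lp_modular_def)
  also have "\<dots> \<le> ennreal (1/m) * ennreal m"
    using m by (intro mult_left_mono) auto
  also have "\<dots> = 1"
    using m by (subst ennreal_mult[symmetric]) auto
  finally have "Lp_norm \<mu> p u \<le> ennreal (1 / (d * c))"
    using c d by (intro Lp_norm_leI) auto
  then show ?thesis by (simp add: order.strict_trans1)
qed

section \<open>Sequence norms\<close>

lemma eabs_le_lq_norm:
  assumes "0 < q"
  shows "eabs (a k) \<le> lq_norm q a"
proof (cases q)
  case (real q')
  with assms have q: "q = ereal q'" "0 < q'" by auto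
  have "epowr (eabs (a k)) q = (\<Sum>\<^sub>\<infinity>i\<in>{k}. epowr (eabs (a i)) q)"
    by simp
  also have "\<dots> \<le> (\<Sum>\<^sub>\<infinity>i. epowr (eabs (a i)) q)"
    by (rule infsum_mono_neutral) (auto intro: nonneg_summable_on_complete)
  finally have "epowr (epowr (eabs (a k)) q) (1 / q) \<le> epowr (\<Sum>\<^sub>\<infinity>i. epowr (eabs (a i)) q) (1 / q)"
    using q epowr_mono[of _ _ "1 / q'"] by (simp add: one_ereal_def)
  then show ?thesis
    using q by (simp add: epowr_root lq_norm_def)
qed (use assms in \<open>auto simp: lq_norm_def intro: SUP_upper\<close>)

text \<open>Since \<open>\<gamma> k \<le> 1\<close>, the sum of the \<open>\<gamma> k\<^sup>q\<close> is at most the sum of the \<open>\<gamma> k\<^sup>l\<close>: one sequence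
  works for all exponents \<open>q \<ge> l\<close> at once.\<close>

lemma lq_norm_le:
  assumes l: "0 < l" "ereal l \<le> q"
    and \<gamma>: "\<And>k. 0 < \<gamma> k" "\<And>k. \<gamma> k \<le> 1" "\<And>S. finite S \<Longrightarrow> (\<Sum>k\<in>S. \<gamma> k powr l) \<le> 1"
    and a: "\<And>k. eabs (a k) \<le> ennreal (\<gamma> k) * M"
  shows "lq_norm q a \<le> M"
proof (cases q)
  case (real q')
  with l have q: "q = ereal q'" "0 < q'" "l \<le> q'" by auto
  have "(\<Sum>\<^sub>\<infinity>k. epowr (eabs (a k)) q) \<le> epowr M q"
  proof (rule infsum_le_finite_sums)
    fix S :: "int set" assume S: "finite S"
    have "(\<Sum>k\<in>S. epowr (eabs (a k)) q) \<le> (\<Sum>k\<in>S. ennreal (\<gamma> k powr l) * epowr M q)"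
    proof (rule sum_mono)
      fix k
      have "epowr (eabs (a k)) q \<le> ennreal (\<gamma> k powr q') * epowr M q"
        using epowr_mono[OF a[of k], of q'] q epowr_cmult[OF \<gamma>(1)] by simp
      also have "\<dots> \<le> ennreal (\<gamma> k powr l) * epowr M q"
        using \<gamma>(1)[of k] \<gamma>(2)[of k] q
        by (intro mult_right_mono ennreal_leI powr_mono') auto
      finally show "epowr (eabs (a k)) q \<le> ennreal (\<gamma> k powr l) * epowr M q" .
    qed
    also have "\<dots> = ennreal (\<Sum>k\<in>S. \<gamma> k powr l) * epowr M q"
      by (simp add: sum_distrib_right[symmetric] sum_ennreal)
    also have "\<dots> \<le> ennreal 1 * epowr M q"
      using \<gamma>(3)[OF S] by (intro mult_right_mono ennreal_leI) auto
    finally show "(\<Sum>k\<in>S. epowr (eabs (a k)) q) \<le> epowr M q" by simp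
  qed (simp_all add: nonneg_summable_on_complete)
  then have "epowr (\<Sum>\<^sub>\<infinity>k. epowr (eabs (a k)) q) (1 / q) \<le> epowr (epowr M q) (1 / q)"
    using q epowr_mono[of _ _ "1 / q'"] by (simp add: one_ereal_def)
  then show ?thesis
    using q by (simp add: epowr_root lq_norm_def)
next
  case PInf
  have "eabs (a k) \<le> M" for k
  proof -
    have "ennreal (\<gamma> k) * M \<le> ennreal 1 * M"
      using \<gamma>(2)[of k] by (intro mult_right_mono ennreal_leI) auto
    with a[of k] show ?thesis by simp
  qed
  with PInf show ?thesis by (auto simp: lq_norm_def intro!: SUP_least)
qed (use l in auto)

text \<open>The common factor of the bounds on the \<open>h k\<close> is \<open>c\<close> times an element of the modular unit
  ball. For the first norm the pointwise \<open>\<ell>\<^sup>r\<close>-norm of \<open>h\<close> is at most this common factor, by the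
  preceding lemma. For the second norm, the weight \<open>\<lambda>\<^sub>k = (\<gamma> k)\<^sup>l\<close> is
  admissible because \<open>\<gamma> k \<le> 1\<close> and \<open>l \<le> r\<close> imply \<open>\<gamma> k \<le> \<lambda>\<^sub>k\<^sup>1\<^sup>/\<^sup>r\<close>.\<close>

lemma mixed_norms_le:
  assumes p: "bounded_below_exponent \<mu> j p"
    and l: "0 < l" "AE x in \<mu>. ereal l \<le> r x"
    and \<gamma>: "\<And>k. 0 < \<gamma> k" "\<And>k. \<gamma> k \<le> 1" "\<And>S. finite S \<Longrightarrow> (\<Sum>k\<in>S. \<gamma> k powr l) \<le> 1"
    and [measurable]: "f \<in> borel_measurable \<mu>" "g \<in> borel_measurable \<mu>"
    and le1: "Lp_modular \<mu> p f \<le> 1" "Lp_modular \<mu> p g \<le> 1"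
    and c: "0 < c"
    and h: "\<And>k x. eabs (h k x)
      \<le> ennreal (\<gamma> k) * (ennreal c * (ennreal (shrink j) * max (eabs (f x)) (eabs (g x))))"
  shows "Lp_lq_norm \<mu> p r h \<le> ennreal c" "lq_Lp_norm \<mu> p r h \<le> ennreal c"
proof -
  define m where "m x = ennreal (shrink j) * max (eabs (f x)) (eabs (g x))" for x
  have h: "eabs (h k x) \<le> ennreal (\<gamma> k) * (ennreal c * m x)" for k x
    using h unfolding m_def .
  have rescale: "ennreal (inverse c) * (ennreal c * y) = y" for y
    using c by (simp add: mult.assoc[symmetric] ennreal_mult[symmetric])
  show "Lp_lq_norm \<mu> p r h \<le> ennreal c"
    unfolding Lp_lq_norm_def
  proof (intro Lp_norm_leI c Lp_modular_shrink_max[OF p _ _ le1])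
    show "AE x in \<mu>. eabs (enn2ereal (lq_norm (r x) (\<lambda>k. h k x)) / ereal c)
        \<le> ennreal (shrink j) * max (eabs (f x)) (eabs (g x))"
      using l(2)
    proof eventually_elim
      case (elim x)
      have "lq_norm (r x) (\<lambda>k. h k x) \<le> ennreal c * m x"
        by (rule lq_norm_le[OF l(1) elim \<gamma> h])
      then have "ennreal (inverse c) * lq_norm (r x) (\<lambda>k. h k x) \<le> ennreal (inverse c) * (ennreal c * m x)"
        by (rule mult_left_mono) simp
      then show ?case
        unfolding rescale eabs_divide[OF c] eabs_enn2ereal m_def .
    qed
  qed auto
  have "lq_Lp_modular \<mu> p r (\<lambda>k x. h k x / ereal c) \<le> 1"
    unfolding lq_Lp_modular_def
  proof (rule infsum_le_finite_sums)
    fix S :: "int set" assume S: "finite S"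
    let ?I = "\<lambda>k. INF l\<in>{l::real. 0 < l \<and>
        Lp_modular \<mu> p (\<lambda>x. h k x / ereal c / ereal (l powr real_of_ereal (1 / r x))) \<le> 1}. ennreal l"
    have "(\<Sum>k\<in>S. ?I k) \<le> (\<Sum>k\<in>S. ennreal (\<gamma> k powr l))"
    proof (rule sum_mono)
      fix k
      let ?w = "\<lambda>x. (\<gamma> k powr l) powr real_of_ereal (1 / r x)"
      have "Lp_modular \<mu> p (\<lambda>x. h k x / ereal c / ereal (?w x)) \<le> 1"
      proof (rule Lp_modular_shrink_max[OF p _ _ le1])
        show "AE x in \<mu>. eabs (h k x / ereal c / ereal (?w x))
            \<le> ennreal (shrink j) * max (eabs (f x)) (eabs (g x))"
          using l(2)
        proof eventually_elim
          case (elim x)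
          have "l * real_of_ereal (1 / r x) \<le> 1"
            using elim l(1) by (cases "r x") (auto simp: one_ereal_def)
          then have "\<gamma> k powr 1 \<le> \<gamma> k powr (l * real_of_ereal (1 / r x))"
            using \<gamma>(1)[of k] \<gamma>(2)[of k] by (intro powr_mono') auto
          then have w: "\<gamma> k \<le> ?w x" and w0: "0 < ?w x"
            using \<gamma>(1)[of k] by (auto simp: powr_powr)
          have "eabs (h k x / ereal c / ereal (?w x))
              = ennreal (inverse (?w x)) * (ennreal (inverse c) * eabs (h k x))"
            using c w0 by (simp add: eabs_divide)
          also have "\<dots> \<le> ennreal (inverse (?w x)) * (ennreal (inverse c) * (ennreal (\<gamma> k) * (ennreal c * m x)))"
            by (intro mult_left_mono h) auto
          also have "\<dots> = ennreal (inverse (?w x) * \<gamma> k) * (ennreal (inverse c) * (ennreal c * m x))"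
            using \<gamma>(1)[of k] w0 by (simp add: ennreal_mult mult_ac)
          also have "\<dots> \<le> ennreal 1 * m x"
            unfolding rescale using w w0 by (intro mult_right_mono ennreal_leI) (auto simp: field_simps)
          finally show ?case by (simp add: m_def)
        qed
      qed auto
      then show "?I k \<le> ennreal (\<gamma> k powr l)"
        using \<gamma>(1)[of k] by (intro INF_lower) auto
    qed
    also have "\<dots> = ennreal (\<Sum>k\<in>S. \<gamma> k powr l)"
      by (simp add: sum_ennreal)
    also have "\<dots> \<le> ennreal 1"
      using \<gamma>(3)[OF S] by (rule ennreal_leI)
    finally show "(\<Sum>k\<in>S. ?I k) \<le> 1" by simp
  qed (simp_all add: nonneg_summable_on_complete)
  then show "lq_Lp_norm \<mu> p r h \<le> ennreal c"
    unfolding lq_Lp_norm_def using c by (intro INF_lower) auto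
qed

section \<open>The seminorm with third exponent infinity\<close>

text \<open>The space with third exponent \<open>\<infinity>\<close> is the largest one, and its norm is the
  \<open>L\<^sup>p\<close>-norm of a pointwise supremum. Estimating everything by it makes the exponent
  \<open>q\<close> disappear.\<close>

lemma M_seminorm_infinity_le:
  assumes "bounded_below_exponent \<mu> l p" "\<And>x. 0 < q x"
  shows "M_seminorm \<mu> s p (\<lambda>_. \<infinity>) u \<le> M_seminorm \<mu> s p q u"
  unfolding M_seminorm_def Lp_lq_norm_def
proof (intro INF_mono bexI)
  fix g
  show "Lp_norm \<mu> p (\<lambda>x. enn2ereal (lq_norm \<infinity> (\<lambda>k. g k x)))
      \<le> Lp_norm \<mu> p (\<lambda>x. enn2ereal (lq_norm (q x) (\<lambda>k. g k x)))"
    using assms(1)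
  proof (rule Lp_norm_mono)
    fix x
    have "lq_norm \<infinity> (\<lambda>k. g k x) \<le> lq_norm (q x) (\<lambda>k. g k x)"
      using assms(2)[of x] unfolding lq_norm_def[of \<infinity>]
      by (auto intro!: SUP_least eabs_le_lq_norm)
    then show "eabs (enn2ereal (lq_norm \<infinity> (\<lambda>k. g k x)))
        \<le> eabs (enn2ereal (lq_norm (q x) (\<lambda>k. g k x)))"
      unfolding eabs_enn2ereal .
  qed
qed

lemma measurable_sup_norm:
  assumes "\<And>k. g k \<in> borel_measurable \<mu>"
  shows "(\<lambda>x. enn2ereal (lq_norm \<infinity> (\<lambda>k. g k x))) \<in> borel_measurable \<mu>"
proof -
  have [measurable]: "\<And>k. g k \<in> borel_measurable \<mu>" by (rule assms)
  show ?thesis unfolding lq_norm_def by simp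
qed

lemma vector_gradient_diff:
  assumes g: "g \<in> vector_gradients \<mu> s u" and h: "h \<in> vector_gradients \<mu> s v"
  shows "(\<lambda>k x. g k x + h k x) \<in> vector_gradients \<mu> s (\<lambda>x. u x - v x)"
proof -
  obtain N where N: "N \<in> null_sets \<mu>"
    "\<And>k x y. x \<in> - N \<Longrightarrow> y \<in> - N \<Longrightarrow> 2 powi (- k - 1) \<le> dist x y \<and> dist x y < 2 powi (- k) \<Longrightarrow>
      \<bar>u x - u y\<bar> \<le> ereal (dist x y powr real_of_ereal (s x)) * g k x
                   + ereal (dist x y powr real_of_ereal (s y)) * g k y"
    and g': "\<And>k. g k \<in> borel_measurable \<mu>" "\<And>k x. 0 \<le> g k x"
    using g by (auto simp: vector_gradients_def)
  obtain N' where N': "N' \<in> null_sets \<mu>"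
    "\<And>k x y. x \<in> - N' \<Longrightarrow> y \<in> - N' \<Longrightarrow> 2 powi (- k - 1) \<le> dist x y \<and> dist x y < 2 powi (- k) \<Longrightarrow>
      \<bar>v x - v y\<bar> \<le> ereal (dist x y powr real_of_ereal (s x)) * h k x
                   + ereal (dist x y powr real_of_ereal (s y)) * h k y"
    and h': "\<And>k. h k \<in> borel_measurable \<mu>" "\<And>k x. 0 \<le> h k x"
    using h by (auto simp: vector_gradients_def)
  have diff: "\<bar>(a - b) - (c - d)\<bar> \<le> \<bar>a - c\<bar> + \<bar>b - d\<bar>" for a b c d :: ereal
    by (cases a; cases b; cases c; cases d) auto
  show ?thesis
    unfolding vector_gradients_def
  proof (intro CollectI conjI allI bexI[of _ "N \<union> N'"] ballI impI)
    fix k :: int and x y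
    assume xy: "x \<in> - (N \<union> N')" "y \<in> - (N \<union> N')"
      and d: "2 powi (- k - 1) \<le> dist x y \<and> dist x y < 2 powi (- k)"
    have "\<bar>(u x - v x) - (u y - v y)\<bar> \<le> \<bar>u x - u y\<bar> + \<bar>v x - v y\<bar>"
      by (rule diff)
    also have "\<dots> \<le> (ereal (dist x y powr real_of_ereal (s x)) * g k x
                   + ereal (dist x y powr real_of_ereal (s y)) * g k y)
                + (ereal (dist x y powr real_of_ereal (s x)) * h k x
                   + ereal (dist x y powr real_of_ereal (s y)) * h k y)"
      using xy d by (intro add_mono N(2) N'(2)) auto
    also have "\<dots> = ereal (dist x y powr real_of_ereal (s x)) * (g k x + h k x)
                + ereal (dist x y powr real_of_ereal (s y)) * (g k y + h k y)"
      using g'(2) h'(2) by (simp add: ereal_right_distrib add_ac)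
    finally show "\<bar>(u x - v x) - (u y - v y)\<bar>
        \<le> ereal (dist x y powr real_of_ereal (s x)) * (g k x + h k x)
          + ereal (dist x y powr real_of_ereal (s y)) * (g k y + h k y)" .
  qed (use N(1) N'(1) g' h' in \<open>auto intro: null_sets.Un\<close>)
qed

lemma M_seminorm_lessE:
  assumes "M_seminorm \<mu> s p q u < c"
  obtains g where "g \<in> vector_gradients \<mu> s u" "Lp_lq_norm \<mu> p q g < c"
  using assms by (auto simp: M_seminorm_def INF_less_iff)

lemma M_seminorm_infinity_quasi_triangle:
  assumes p: "bounded_below_exponent \<mu> l p" and a: "0 < a"
    and u: "M_seminorm \<mu> s p (\<lambda>_. \<infinity>) u < ennreal a"
    and v: "M_seminorm \<mu> s p (\<lambda>_. \<infinity>) v < ennreal a"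
  shows "M_seminorm \<mu> s p (\<lambda>_. \<infinity>) (\<lambda>x. u x - v x) \<le> ennreal (quasi_const l * a)"
proof -
  obtain g where g: "g \<in> vector_gradients \<mu> s u" "Lp_lq_norm \<mu> p (\<lambda>_. \<infinity>) g < ennreal a"
    using u by (rule M_seminorm_lessE)
  obtain h where h: "h \<in> vector_gradients \<mu> s v" "Lp_lq_norm \<mu> p (\<lambda>_. \<infinity>) h < ennreal a"
    using v by (rule M_seminorm_lessE)
  have meas: "\<And>k. g k \<in> borel_measurable \<mu>" "\<And>k. h k \<in> borel_measurable \<mu>"
    using g(1) h(1) by (auto simp: vector_gradients_def)
  have "M_seminorm \<mu> s p (\<lambda>_. \<infinity>) (\<lambda>x. u x - v x)
      \<le> Lp_lq_norm \<mu> p (\<lambda>_. \<infinity>) (\<lambda>k x. g k x + h k x)"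
    unfolding M_seminorm_def by (intro INF_lower vector_gradient_diff g h)
  also have "\<dots> \<le> ennreal (quasi_const l * a)"
    unfolding Lp_lq_norm_def
  proof (rule Lp_norm_quasi_triangle[OF p measurable_sup_norm measurable_sup_norm a])
    fix x
    show "eabs (enn2ereal (lq_norm \<infinity> (\<lambda>k. g k x + h k x)))
        \<le> eabs (enn2ereal (lq_norm \<infinity> (\<lambda>k. g k x))) + eabs (enn2ereal (lq_norm \<infinity> (\<lambda>k. h k x)))"
      unfolding eabs_enn2ereal lq_norm_def
      by (auto intro!: SUP_least order_trans[OF eabs_add] add_mono SUP_upper)
  qed (use g(2) h(2) meas in \<open>auto simp: Lp_lq_norm_def\<close>)
  finally show ?thesis .
qed

section \<open>Lowering the smoothness\<close>

lemma geometric_sum_int: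
  assumes "0 < \<theta>"
  obtains B :: real where "0 < B" "\<And>S::int set. finite S \<Longrightarrow> (\<Sum>k\<in>S. 2 powr (- \<theta> * \<bar>real_of_int k\<bar>)) \<le> B"
proof -
  define x where "x = 2 powr (- \<theta>)"
  have x: "0 < x" "x < 1"
    using assms by (auto simp: x_def powr_less_one)
  have pow: "2 powr (- \<theta> * \<bar>real_of_int k\<bar>) = x ^ nat \<bar>k\<bar>" for k
  proof -
    have "x ^ nat \<bar>k\<bar> = x powr real (nat \<bar>k\<bar>)"
      using x by (simp only: powr_realpow)
    then show ?thesis by (simp add: x_def powr_powr)
  qed
  have half: "(\<Sum>k\<in>T. x ^ nat \<bar>k\<bar>) \<le> 1 / (1 - x)" if "finite T" "inj_on (\<lambda>k. nat \<bar>k\<bar>) T" for T :: "int set"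
  proof -
    have "(\<Sum>k\<in>T. x ^ nat \<bar>k\<bar>) = (\<Sum>i\<in>(\<lambda>k. nat \<bar>k\<bar>) ` T. x ^ i)"
      using that by (simp add: sum.reindex)
    also have "\<dots> \<le> (\<Sum>i. x ^ i)"
      using x that by (intro sum_le_suminf summable_geometric) auto
    also have "\<dots> = 1 / (1 - x)"
      using x by (intro suminf_geometric) auto
    finally show ?thesis .
  qed
  \<comment> \<open>\<open>k \<mapsto> \<bar>k\<bar>\<close> is injective on the nonnegative and on the negative integers separately, so each
    half is bounded by the full geometric series.\<close>
  show ?thesis
  proof (rule that)
    show "0 < 2 / (1 - x)" using x by simp
    fix S :: "int set" assume S: "finite S"
    have "(\<Sum>k\<in>S. x ^ nat \<bar>k\<bar>)
        = (\<Sum>k\<in>S \<inter> {0..}. x ^ nat \<bar>k\<bar>) + (\<Sum>k\<in>S \<inter> - {0..}. x ^ nat \<bar>k\<bar>)"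
      using S by (subst sum.union_disjoint[symmetric]) (auto intro!: sum.cong)
    also have "\<dots> \<le> 1 / (1 - x) + 1 / (1 - x)"
      using S by (intro add_mono half) (auto simp: inj_on_def)
    finally show "(\<Sum>k\<in>S. 2 powr (- \<theta> * \<bar>real_of_int k\<bar>)) \<le> 2 / (1 - x)"
      unfolding pow by (simp add: field_simps)
  qed
qed

lemma geometric_weights:
  assumes "0 < \<theta>" "0 < l"
  obtains C :: real where "0 < C"
    "\<And>k::int. 2 powr (- \<theta> * \<bar>real_of_int k\<bar>) / C \<le> 1"
    "\<And>S::int set. finite S \<Longrightarrow> (\<Sum>k\<in>S. (2 powr (- \<theta> * \<bar>real_of_int k\<bar>) / C) powr l) \<le> 1"
proof -
  obtain B where B: "0 < B"
    "\<And>S::int set. finite S \<Longrightarrow> (\<Sum>k\<in>S. 2 powr (- (\<theta> * l) * \<bar>real_of_int k\<bar>)) \<le> B"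
    using geometric_sum_int[of "\<theta> * l"] assms by auto
  define C where "C = B powr (1 / l)"
  have C: "0 < C" using B by (simp add: C_def)
  have weight: "(2 powr (- \<theta> * \<bar>real_of_int k\<bar>) / C) powr l = 2 powr (- (\<theta> * l) * \<bar>real_of_int k\<bar>) / B" for k
    using B(1) assms C by (simp add: powr_divide powr_powr C_def mult_ac)
  have sums: "(\<Sum>k\<in>S. (2 powr (- \<theta> * \<bar>real_of_int k\<bar>) / C) powr l) \<le> 1" if "finite S" for S :: "int set"
    unfolding weight using B that by (simp add: sum_divide_distrib[symmetric])
  have "2 powr (- \<theta> * \<bar>real_of_int k\<bar>) / C \<le> 1" for k
  proof (rule ccontr)
    assume "\<not> ?thesis"
    then have "1 < (2 powr (- \<theta> * \<bar>real_of_int k\<bar>) / C) powr l"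
      using assms by (intro gr_one_powr) auto
    with sums[of "{k}"] show False by simp
  qed
  with C sums show ?thesis by (intro that[of C]) auto
qed

text \<open>At scale \<open>d(x,y) \<approx> 2\<^sup>-\<^sup>k\<close> with \<open>k \<ge> K \<ge> 0\<close> the surplus
  \<open>d(x,y)\<^sup>s\<^sup>-\<^sup>t\<close> yields the decaying factor \<open>2\<^sup>-\<^sup>\<delta>\<^sup>k\<close>. At the other scales
  \<open>\<bar>w x - w y\<bar> \<le> \<bar>w x\<bar> + \<bar>w y\<bar>\<close> suffices, and the factor \<open>2 powr max \<dots>\<close> is an upper bound
  for \<open>d(x,y) powr (- t)\<close>, which is at most \<open>2 powr ((k + 1) * t)\<close>; the maximum accounts for both
  signs of \<open>k + 1\<close>.\<close>

lemma vector_gradient_lower_smoothness: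
  assumes sp: "space \<mu> = UNIV" and w: "w \<in> borel_measurable \<mu>"
    and g: "g \<in> vector_gradients \<mu> s w"
    and \<delta>: "0 < \<delta>" "AE x in \<mu>. ereal \<delta> \<le> s x - t x"
    and s: "AE x in \<mu>. 0 \<le> s x \<and> s x < \<infinity>"
    and t: "AE x in \<mu>. ereal \<tau> \<le> t x \<and> t x \<le> ereal T" "0 < \<tau>"
    and K: "0 \<le> K"
  shows "(\<lambda>k x. if k < K then ereal (2 powr max (real_of_int (k + 1) * \<tau>) (real_of_int (k + 1) * T)) * \<bar>w x\<bar>
      else ereal (2 powr (- \<delta> * k)) * g k x) \<in> vector_gradients \<mu> t w"
    (is "?h \<in> _")
proof -
  obtain N where N: "N \<in> null_sets \<mu>"
    "\<And>k x y. x \<in> - N \<Longrightarrow> y \<in> - N \<Longrightarrow> 2 powi (- k - 1) \<le> dist x y \<and> dist x y < 2 powi (- k) \<Longrightarrow>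
      \<bar>w x - w y\<bar> \<le> ereal (dist x y powr real_of_ereal (s x)) * g k x
                   + ereal (dist x y powr real_of_ereal (s y)) * g k y"
    and g': "\<And>k. g k \<in> borel_measurable \<mu>" "\<And>k x. 0 \<le> g k x"
    using g by (auto simp: vector_gradients_def)
  have "AE x in \<mu>. \<bar>s x\<bar> \<noteq> \<infinity> \<and> \<bar>t x\<bar> \<noteq> \<infinity> \<and> \<tau> \<le> real_of_ereal (t x) \<and> real_of_ereal (t x) \<le> T
      \<and> \<delta> \<le> real_of_ereal (s x) - real_of_ereal (t x)"
    using \<delta>(2) s t(1)
  proof eventually_elim
    case (elim x)
    then show ?case by (cases "s x"; cases "t x") auto
  qed
  then obtain N' where N': "N' \<in> null_sets \<mu>"
    "\<And>x. x \<in> - N' \<Longrightarrow> \<tau> \<le> real_of_ereal (t x) \<and> real_of_ereal (t x) \<le> T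
      \<and> \<delta> \<le> real_of_ereal (s x) - real_of_ereal (t x)"
    unfolding eventually_ae_filter sp by blast
  show ?thesis
    unfolding vector_gradients_def
  proof (intro CollectI conjI allI bexI[of _ "N \<union> N'"] ballI impI)
    fix k :: int and x y
    assume xy: "x \<in> - (N \<union> N')" "y \<in> - (N \<union> N')"
      and dk: "2 powi (- k - 1) \<le> dist x y \<and> dist x y < 2 powi (- k)"
    define d where "d = dist x y"
    have d1: "2 powr (- real_of_int (k + 1)) \<le> d"
      using dk powr_real_of_int'[of 2 "- k - 1"] by (simp add: d_def)
    have d2: "d \<le> 2 powr (- real_of_int k)"
      using dk powr_real_of_int'[of 2 "- k"] by (simp add: d_def)
    have d0: "0 < d"
      using d1 by (rule less_le_trans[rotated]) simp
    show "\<bar>w x - w y\<bar> \<le> ereal (dist x y powr real_of_ereal (t x)) * ?h k x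
        + ereal (dist x y powr real_of_ereal (t y)) * ?h k y"
    proof (cases "k < K")
      case True
      define c where "c = 2 powr max (real_of_int (k + 1) * \<tau>) (real_of_int (k + 1) * T)"
      have large: "\<bar>w z\<bar> \<le> ereal (d powr real_of_ereal (t z)) * (ereal c * \<bar>w z\<bar>)"
        if "z \<in> - N'" for z
      proof -
        define tz where "tz = real_of_ereal (t z)"
        have tz: "\<tau> \<le> tz" "tz \<le> T" using N'(2)[OF that] by (auto simp: tz_def)
        have "real_of_int (k + 1) * tz \<le> max (real_of_int (k + 1) * \<tau>) (real_of_int (k + 1) * T)"
        proof (cases "0 \<le> k + 1")
          case True
          then have "real_of_int (k + 1) * tz \<le> real_of_int (k + 1) * T" using tz by (intro mult_left_mono) auto
          then show ?thesis by simp
        next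
          case False
          then have "real_of_int (k + 1) * tz \<le> real_of_int (k + 1) * \<tau>" using tz by (intro mult_left_mono_neg) auto
          then show ?thesis by simp
        qed
        then have "2 powr (real_of_int (k + 1) * tz) \<le> c"
          unfolding c_def by (intro powr_mono) auto
        moreover have "2 powr (- (real_of_int (k + 1) * tz)) \<le> d powr tz"
          unfolding minus_mult_left powr_powr[symmetric]
          using tz t(2) d1 by (intro powr_mono2) auto
        ultimately have "2 powr (- (real_of_int (k + 1) * tz)) * 2 powr (real_of_int (k + 1) * tz) \<le> d powr tz * c"
          by (intro mult_mono) auto
        then have "1 \<le> d powr tz * c"
          by (simp flip: powr_add)
        then have "1 * \<bar>w z\<bar> \<le> ereal (d powr tz * c) * \<bar>w z\<bar>"
          by (intro ereal_mult_right_mono) (auto simp: one_ereal_def)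
        then show ?thesis by (simp add: tz_def mult.assoc flip: times_ereal.simps(1))
      qed
      have "\<bar>w x - w y\<bar> \<le> \<bar>w x\<bar> + \<bar>w y\<bar>"
        by (cases "w x"; cases "w y") auto
      also have "\<dots> \<le> ereal (d powr real_of_ereal (t x)) * (ereal c * \<bar>w x\<bar>)
          + ereal (d powr real_of_ereal (t y)) * (ereal c * \<bar>w y\<bar>)"
        using xy by (intro add_mono large) auto
      finally show ?thesis using True by (simp add: c_def d_def)
    next
      case False
      have small: "ereal (d powr real_of_ereal (s z)) * g k z
          \<le> ereal (d powr real_of_ereal (t z)) * (ereal (2 powr (- \<delta> * k)) * g k z)"
        if "z \<in> - N'" for z
      proof -
        define tz sz where "tz = real_of_ereal (t z)" and "sz = real_of_ereal (s z)"
        have tz: "\<delta> \<le> sz - tz" using N'(2)[OF that] by (auto simp: tz_def sz_def)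
        have "d \<le> 2 powr 0"
          using d2 by (rule order_trans) (use False K in \<open>intro powr_mono, auto\<close>)
        then have "d powr (sz - tz) \<le> d powr \<delta>"
          using d0 tz by (intro powr_mono') auto
        also have "\<dots> \<le> (2 powr (- real_of_int k)) powr \<delta>"
          using d0 d2 \<delta>(1) by (intro powr_mono2) auto
        also have "\<dots> = 2 powr (- \<delta> * k)"
          by (simp add: powr_powr mult.commute)
        finally have "d powr tz * d powr (sz - tz) \<le> d powr tz * 2 powr (- \<delta> * k)"
          by (intro mult_left_mono) auto
        then have "d powr sz \<le> d powr tz * 2 powr (- \<delta> * k)"
          by (simp flip: powr_add)
        then have "ereal (d powr sz) * g k z \<le> ereal (d powr tz * 2 powr (- \<delta> * k)) * g k z"
          by (intro ereal_mult_right_mono) (auto simp: g')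
        then show ?thesis by (simp add: tz_def sz_def mult.assoc flip: times_ereal.simps(1))
      qed
      have "\<bar>w x - w y\<bar> \<le> ereal (d powr real_of_ereal (s x)) * g k x
          + ereal (d powr real_of_ereal (s y)) * g k y"
        using N(2)[of x y k] xy dk by (simp add: d_def)
      also have "\<dots> \<le> ereal (d powr real_of_ereal (t x)) * (ereal (2 powr (- \<delta> * k)) * g k x)
          + ereal (d powr real_of_ereal (t y)) * (ereal (2 powr (- \<delta> * k)) * g k y)"
        using xy by (intro add_mono small) auto
      finally show ?thesis using False by (simp add: d_def)
    qed
  qed (use N(1) N'(1) g' w in \<open>auto intro: null_sets.Un\<close>)
qed

section \<open>An interpolation inequality of Ehrling type\<close>

text \<open>The gradient of the preceding lemma is dominated by \<open>\<gamma> k\<close> times a small multiple of the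
  supremum of the \<open>g k\<close> when \<open>k \<ge> K\<close>, and by \<open>\<gamma> k\<close> times a large multiple of \<open>\<bar>w\<bar>\<close> when
  \<open>k < K\<close>. Here \<open>\<gamma> k = 2\<^sup>-\<^sup>\<theta>\<^sup>\<bar>\<^sup>k\<^sup>\<bar> / C\<close>, where \<open>\<theta> \<le> \<delta>/2\<close> leaves half of the
  decay \<open>2\<^sup>-\<^sup>\<delta>\<^sup>k\<close> to beat \<open>e\<close>, and \<open>\<theta> \<le> \<tau>\<close> lets the lower bound \<open>\<tau>\<close> of \<open>t\<close> provide the decay
  as \<open>k\<close> tends to \<open>-\<infinity>\<close>.\<close>

lemma ehrling_inequality:
  assumes sp: "space \<mu> = UNIV" and p: "bounded_below_exponent \<mu> j p"
    and s: "s \<in> bdd_exponents \<mu>" and t: "t \<in> bdd_exponents \<mu>" and ts: "exponent_ll \<mu> t s"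
    and r: "r \<in> exponents \<mu>" and e: "0 < e"
  obtains A :: real where "0 < A"
    "\<And>w a b. w \<in> borel_measurable \<mu> \<Longrightarrow> 0 < a \<Longrightarrow> 0 < b \<Longrightarrow> Lp_norm \<mu> p w < ennreal a \<Longrightarrow>
      M_seminorm \<mu> s p (\<lambda>_. \<infinity>) w < ennreal b \<Longrightarrow>
      M_seminorm \<mu> t p r w \<le> ennreal (A * a + e * b) \<and>
      N_seminorm \<mu> t p r w \<le> ennreal (A * a + e * b)"
proof -
  obtain \<delta> where \<delta>: "0 < \<delta>" "AE x in \<mu>. ereal \<delta> \<le> s x - t x"
    using ts essinf_posE unfolding exponent_ll_def by blast
  obtain l where l: "0 < l" "AE x in \<mu>. ereal l \<le> r x"
    using r essinf_posE by (auto simp: exponents_def)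
  obtain \<tau> T where t': "0 < \<tau>" "\<tau> \<le> T" "AE x in \<mu>. ereal \<tau> \<le> t x \<and> t x \<le> ereal T"
    using bdd_exponent_bounds[OF t] .
  obtain \<sigma> where "bounded_below_exponent \<mu> \<sigma> s"
    using bdd_exponent_bounded_below[OF s] .
  then have "0 < \<sigma>" "AE x in \<mu>. ereal \<sigma> \<le> s x \<and> s x < \<infinity>"
    by (auto simp: bounded_below_exponent_def)
  from this(2) have s': "AE x in \<mu>. 0 \<le> s x \<and> s x < \<infinity>"
    by eventually_elim (use \<open>0 < \<sigma>\<close> in \<open>auto intro: order_trans[of 0 "ereal \<sigma>"]\<close>)
  define \<kappa> where "\<kappa> = shrink j"
  have \<kappa>: "0 < \<kappa>" by (simp add: \<kappa>_def shrink_pos)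
  define \<theta> where "\<theta> = min \<tau> (\<delta> / 2)"
  have \<theta>: "0 < \<theta>" "\<theta> \<le> \<tau>" "\<theta> \<le> \<delta> / 2" using \<delta> t' by (auto simp: \<theta>_def)
  obtain C where C: "0 < C" "\<And>k::int. 2 powr (- \<theta> * \<bar>real_of_int k\<bar>) / C \<le> 1"
    "\<And>S::int set. finite S \<Longrightarrow> (\<Sum>k\<in>S. (2 powr (- \<theta> * \<bar>real_of_int k\<bar>) / C) powr l) \<le> 1"
    using geometric_weights[OF \<theta>(1) l(1)] by blast
  define \<gamma> where "\<gamma> k = 2 powr (- \<theta> * \<bar>real_of_int k\<bar>) / C" for k :: int
  have \<gamma>: "0 < \<gamma> k" "\<gamma> k \<le> 1" "finite S \<Longrightarrow> (\<Sum>k\<in>S. \<gamma> k powr l) \<le> 1" for k S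
    using C by (auto simp: \<gamma>_def)
  \<comment> \<open>From \<open>K\<close> on, half of the decay of \<open>2\<^sup>-\<^sup>\<delta>\<^sup>k\<close> suffices to absorb the factor \<open>e\<close>.\<close>
  obtain K :: int where K: "0 \<le> K" "2 powr (- (\<delta> / 2) * K) \<le> e * \<kappa> / C"
  proof -
    have "0 < e * \<kappa> / C" using e \<kappa> C by simp
    moreover have "2 powr (- (\<delta> / 2)) < 1" using \<delta>(1) by (simp add: powr_less_one)
    ultimately obtain n where "(2 powr (- (\<delta> / 2))) ^ n < e * \<kappa> / C"
      using real_arch_pow_inv by blast
    also have "(2 powr (- (\<delta> / 2))) ^ n = 2 powr (- (\<delta> / 2) * int n)"
      by (simp add: powr_realpow[symmetric] powr_powr)
    finally show ?thesis by (intro that[of "int n"]) auto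
  qed
  define c where "c k = 2 powr max (real_of_int (k + 1) * \<tau>) (real_of_int (k + 1) * T)" for k
  define D where "D = (real_of_int K + 1) * T + K * \<theta>"
  define A where "A = 2 powr D * C / \<kappa>"
  have A: "0 < A" using C \<kappa> by (simp add: A_def)
  have high: "2 powr (- \<delta> * k) \<le> e * \<kappa> * \<gamma> k" if "K \<le> k" for k
  proof -
    have "(\<delta> / 2) * K \<le> (\<delta> / 2) * k"
      using that \<delta>(1) by (intro mult_left_mono) auto
    then have le_K: "2 powr (- (\<delta> / 2) * k) \<le> 2 powr (- (\<delta> / 2) * K)"
      by (intro powr_mono) auto
    have "\<theta> * \<bar>real_of_int k\<bar> \<le> (\<delta> / 2) * \<bar>real_of_int k\<bar>"
      using \<theta>(3) by (rule mult_right_mono) simp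
    moreover have "\<bar>real_of_int k\<bar> = real_of_int k"
      using that K(1) by simp
    ultimately have le_weight: "2 powr (- (\<delta> / 2) * k) \<le> 2 powr (- \<theta> * \<bar>real_of_int k\<bar>)"
      by (intro powr_mono) auto
    have "2 powr (- \<delta> * k) = 2 powr (- (\<delta> / 2) * k) * 2 powr (- (\<delta> / 2) * k)"
      by (simp flip: powr_add)
    also have "\<dots> \<le> 2 powr (- (\<delta> / 2) * K) * 2 powr (- \<theta> * \<bar>real_of_int k\<bar>)"
      using le_K le_weight by (rule mult_mono) auto
    also have "\<dots> \<le> (e * \<kappa> / C) * 2 powr (- \<theta> * \<bar>real_of_int k\<bar>)"
      using K(2) by (intro mult_right_mono) auto
    finally show ?thesis by (simp add: \<gamma>_def)
  qed
  have low: "c k \<le> A * \<kappa> * \<gamma> k" if "k < K" for k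
  proof -
    have KT: "0 \<le> K * T" and K\<theta>: "0 \<le> K * \<theta>" using K t' \<theta> by auto
    have "max (real_of_int (k + 1) * \<tau>) (real_of_int (k + 1) * T) \<le> D - \<theta> * \<bar>real_of_int k\<bar>"
    proof (cases "0 \<le> k")
      case True
      have "real_of_int (k + 1) * \<tau> \<le> real_of_int (k + 1) * T"
        using True t' by (intro mult_left_mono) auto
      moreover have "real_of_int (k + 1) * T \<le> (real_of_int K + 1) * T"
        using that t' by (intro mult_right_mono) auto
      moreover have "\<theta> * \<bar>real_of_int k\<bar> \<le> K * \<theta>"
        using that True \<theta> by simp
      ultimately show ?thesis by (simp add: D_def)
    next
      case False
      then have "real_of_int (k + 1) * T \<le> real_of_int (k + 1) * \<tau>"
        using t' by (intro mult_left_mono_neg) auto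
      moreover have "real_of_int k * \<tau> \<le> real_of_int k * \<theta>"
        using False \<theta> by (intro mult_left_mono_neg) auto
      moreover have "real_of_int (k + 1) * \<tau> = real_of_int k * \<tau> + \<tau>"
        by (simp add: algebra_simps)
      moreover have "\<theta> * \<bar>real_of_int k\<bar> = - (real_of_int k * \<theta>)"
        using False by simp
      moreover have "T \<le> D"
        using KT K\<theta> by (simp add: D_def algebra_simps)
      ultimately show ?thesis using t'(2) by linarith
    qed
    then have "c k \<le> 2 powr (D + - \<theta> * \<bar>real_of_int k\<bar>)"
      unfolding c_def by (intro powr_mono) auto
    also have "\<dots> = A * \<kappa> * \<gamma> k"
      unfolding powr_add using C \<kappa> by (simp add: A_def \<gamma>_def)
    finally show ?thesis .
  qed
  show ?thesis
  proof (rule that[OF A])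
    fix w a b
    assume w [measurable]: "w \<in> borel_measurable \<mu>" and a: "0 < (a::real)" and b: "0 < (b::real)"
      and wa: "Lp_norm \<mu> p w < ennreal a" and wb: "M_seminorm \<mu> s p (\<lambda>_. \<infinity>) w < ennreal b"
    obtain g where g: "g \<in> vector_gradients \<mu> s w" and gb: "Lp_lq_norm \<mu> p (\<lambda>_. \<infinity>) g < ennreal b"
      using wb by (rule M_seminorm_lessE)
    define G where "G x = enn2ereal (lq_norm \<infinity> (\<lambda>k. g k x))" for x
    have G [measurable]: "G \<in> borel_measurable \<mu>"
      unfolding G_def using g by (intro measurable_sup_norm) (auto simp: vector_gradients_def)
    have gG: "eabs (g k x) \<le> eabs (G x)" for k x
      unfolding G_def eabs_enn2ereal by (rule eabs_le_lq_norm) simp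
    define h where "h = (\<lambda>k x. if k < K then ereal (c k) * \<bar>w x\<bar> else ereal (2 powr (- \<delta> * k)) * g k x)"
    have h: "h \<in> vector_gradients \<mu> t w"
      unfolding h_def c_def using \<delta> t' K s' sp by (intro vector_gradient_lower_smoothness[OF _ _ g]) auto
    define L where "L = A * a + e * b"
    have L: "0 < L" using A a b e by (simp add: L_def add_pos_pos)
    let ?m = "\<lambda>x. max (eabs (w x / ereal a)) (eabs (G x / ereal b))"
    have dom: "eabs (h k x) \<le> ennreal (\<gamma> k) * (ennreal L * (ennreal (shrink j) * ?m x))" for k x
    proof -
      have "eabs (h k x) \<le> ennreal (\<gamma> k * L * \<kappa>) * ?m x"
      proof (cases "k < K")
        case True
        have "c k * a \<le> (A * \<kappa> * \<gamma> k) * a"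
          using low[OF True] a by (intro mult_right_mono) auto
        also have "\<dots> \<le> \<gamma> k * L * \<kappa>"
          using \<gamma>(1)[of k] \<kappa> e b by (simp add: L_def algebra_simps)
        finally have ca: "c k * a \<le> \<gamma> k * L * \<kappa>" .
        have "eabs (h k x) = eabs (ereal (c k) * \<bar>w x\<bar>)"
          using True by (simp add: h_def)
        also have "\<dots> = ennreal (c k) * eabs (w x)"
          by (subst eabs_mult) (auto simp: c_def)
        also have "eabs (w x) = ennreal a * eabs (w x / ereal a)"
          by (rule eabs_rescale[OF a])
        also have "ennreal (c k) * \<dots> = ennreal (c k * a) * eabs (w x / ereal a)"
          using a by (simp add: ennreal_mult c_def mult.assoc)
        also have "\<dots> \<le> ennreal (\<gamma> k * L * \<kappa>) * ?m x"
          by (rule mult_mono[OF ennreal_leI[OF ca] max.cobounded1]) auto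
        finally show ?thesis .
      next
        case False
        then have "2 powr (- \<delta> * k) * b \<le> (e * \<kappa> * \<gamma> k) * b"
          using high[of k] b by (intro mult_right_mono) auto
        also have "\<dots> \<le> \<gamma> k * L * \<kappa>"
          using \<gamma>(1)[of k] \<kappa> A a by (simp add: L_def algebra_simps)
        finally have cb: "2 powr (- \<delta> * k) * b \<le> \<gamma> k * L * \<kappa>" .
        have "eabs (h k x) \<le> ennreal (2 powr (- \<delta> * k)) * (ennreal b * eabs (G x / ereal b))"
          using False gG[of k x] unfolding eabs_rescale[OF b, symmetric]
          by (simp add: h_def eabs_mult mult_left_mono)
        also have "\<dots> = ennreal (2 powr (- \<delta> * k) * b) * eabs (G x / ereal b)"
          using b by (simp add: ennreal_mult mult.assoc)
        also have "\<dots> \<le> ennreal (\<gamma> k * L * \<kappa>) * ?m x"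
          by (rule mult_mono[OF ennreal_leI[OF cb] max.cobounded2]) auto
        finally show ?thesis .
      qed
      also have "\<dots> = ennreal (\<gamma> k) * (ennreal L * (ennreal \<kappa> * ?m x))"
        using \<gamma>(1)[of k] L \<kappa> by (intro ennreal_mult3[symmetric]) auto
      finally show ?thesis by (simp add: \<kappa>_def)
    qed
    have unit: "Lp_modular \<mu> p (\<lambda>x. w x / ereal a) \<le> 1" "Lp_modular \<mu> p (\<lambda>x. G x / ereal b) \<le> 1"
      using Lp_norm_lessD[OF p wa a] Lp_norm_lessD[OF p gb[unfolded Lp_lq_norm_def] b]
      by (auto simp: G_def)
    have meas: "(\<lambda>x. w x / ereal a) \<in> borel_measurable \<mu>" "(\<lambda>x. G x / ereal b) \<in> borel_measurable \<mu>"
      by measurable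
    have "M_seminorm \<mu> t p r w \<le> Lp_lq_norm \<mu> p r h" "N_seminorm \<mu> t p r w \<le> lq_Lp_norm \<mu> p r h"
      unfolding M_seminorm_def N_seminorm_def using h by (auto intro: INF_lower)
    with mixed_norms_le[OF p l \<gamma> meas unit L dom]
    show "M_seminorm \<mu> t p r w \<le> ennreal (A * a + e * b) \<and> N_seminorm \<mu> t p r w \<le> ennreal (A * a + e * b)"
      unfolding L_def by (meson order_trans)
  qed
qed

section \<open>Compact embeddings\<close>

lemma ennreal_pos_real_below:
  assumes "0 < (e::ennreal)"
  obtains c where "0 < c" "ennreal c < e"
proof -
  obtain z where z: "0 < z" "z < e" using dense[OF assms] by blast
  then show ?thesis using that by (cases z) (auto simp: ennreal_zero_less_top)
qed

lemma ennreal_finite_real_above: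
  assumes "(x::ennreal) < \<infinity>"
  obtains c where "0 < c" "x < ennreal c"
proof -
  obtain y where "x = ennreal y" "0 \<le> y" using assms by (cases x) auto
  then show ?thesis by (intro that[of "y + 1"]) (auto simp: ennreal_less_iff)
qed

text \<open>Compactness into \<open>L\<^sup>p\<close> upgrades to compactness into any space whose additional seminorm
  satisfies the interpolation inequality: on a bounded set the term \<open>e * b\<close> is uniformly small, and
  \<open>A * a\<close> is small for functions that are close in \<open>L\<^sup>p\<close>. An \<open>L\<^sup>p\<close>-net need not lie in
  the smaller space; hence its points are replaced by nearby elements of the given bounded set.\<close>

lemma compact_embedding_by_ehrling:
  assumes p: "bounded_below_exponent \<mu> l p" and q: "\<And>x. 0 < q x"
    and cpt: "compact_embedding (M_space \<mu> s p q) (M_norm \<mu> s p q) (Lp_space \<mu> p) (Lp_norm \<mu> p)"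
    and ehrling: "\<And>e. 0 < e \<Longrightarrow> \<exists>A>0. \<forall>w a b. w \<in> borel_measurable \<mu> \<longrightarrow> 0 < a \<longrightarrow> 0 < b \<longrightarrow>
      Lp_norm \<mu> p w < ennreal a \<longrightarrow> M_seminorm \<mu> s p (\<lambda>_. \<infinity>) w < ennreal b \<longrightarrow>
      sem w \<le> ennreal (A * a + e * b)"
  shows "compact_embedding (M_space \<mu> s p q) (M_norm \<mu> s p q)
    {u \<in> Lp_space \<mu> p. sem u < \<infinity>} (\<lambda>u. Lp_norm \<mu> p u + sem u)"
    (is "compact_embedding ?Y ?nY ?Z ?nZ")
proof -
  let ?S = "M_seminorm \<mu> s p (\<lambda>_. \<infinity>)"
  have S_le: "?S u \<le> M_seminorm \<mu> s p q u" for u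
    by (rule M_seminorm_infinity_le[OF p q])
  have nY: "Lp_norm \<mu> p u \<le> ?nY u" "?S u \<le> ?nY u" for u
    unfolding M_norm_def by (auto intro: add_increasing add_increasing2 S_le)
  have Y: "u \<in> Lp_space \<mu> p" "u \<in> borel_measurable \<mu>" if "u \<in> ?Y" for u
    using that by (auto simp: M_space_def Lp_space_def)
  have diff: "(\<lambda>x. u x - v x) \<in> borel_measurable \<mu>" if "u \<in> borel_measurable \<mu>" "v \<in> borel_measurable \<mu>"
    for u v :: "'a \<Rightarrow> ereal"
    using that by measurable
  have YZ: "?Y \<subseteq> ?Z"
  proof
    fix u assume u: "u \<in> ?Y"
    have "?nY u < \<infinity>"
      using u Lp_norm_finite[OF p] by (auto simp: M_space_def M_norm_def)
    then obtain a where a: "0 < a" "?nY u < ennreal a"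
      by (rule ennreal_finite_real_above)
    obtain A where A: "\<forall>w a b. w \<in> borel_measurable \<mu> \<longrightarrow> 0 < a \<longrightarrow> 0 < b \<longrightarrow>
      Lp_norm \<mu> p w < ennreal a \<longrightarrow> ?S w < ennreal b \<longrightarrow> sem w \<le> ennreal (A * a + 1 * b)"
      using ehrling[of 1] by auto
    have "sem u \<le> ennreal (A * a + 1 * a)"
      using a order.strict_trans1[OF nY(1) a(2)] order.strict_trans1[OF nY(2) a(2)]
      by (intro A[rule_format] Y(2)[OF u])
    also have "\<dots> < \<infinity>" by simp
    finally show "u \<in> ?Z" using Y(1)[OF u] by simp
  qed
  have "continuous_inclusion ?Y ?nY ?nZ"
    unfolding continuous_inclusion_def
  proof (intro ballI allI impI)
    fix u and e :: ennreal assume u: "u \<in> ?Y" and "0 < e"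
    obtain e' where e': "0 < e'" "ennreal e' < e"
      using \<open>0 < e\<close> by (rule ennreal_pos_real_below)
    obtain A where A0: "0 < A" and A: "\<forall>w a b. w \<in> borel_measurable \<mu> \<longrightarrow> 0 < a \<longrightarrow> 0 < b \<longrightarrow>
      Lp_norm \<mu> p w < ennreal a \<longrightarrow> ?S w < ennreal b \<longrightarrow> sem w \<le> ennreal (A * a + 1 * b)"
      using ehrling[of 1] by auto
    define d where "d = e' / (A + 2)"
    have d: "0 < d" using e' A0 by (simp add: d_def)
    show "\<exists>d>0. \<forall>v\<in>?Y. ?nY (\<lambda>x. v x - u x) < d \<longrightarrow> ?nZ (\<lambda>x. v x - u x) < e"
    proof (intro exI[of _ "ennreal d"] conjI ballI impI)
      fix v assume v: "v \<in> ?Y" and vd: "?nY (\<lambda>x. v x - u x) < ennreal d"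
      have Lp: "Lp_norm \<mu> p (\<lambda>x. v x - u x) < ennreal d"
        and S: "?S (\<lambda>x. v x - u x) < ennreal d"
        using order.strict_trans1[OF nY(1) vd] order.strict_trans1[OF nY(2) vd] .
      have "sem (\<lambda>x. v x - u x) \<le> ennreal (A * d + 1 * d)"
        by (rule A[rule_format, OF diff[OF Y(2)[OF v] Y(2)[OF u]] d d Lp S])
      with Lp have "?nZ (\<lambda>x. v x - u x) \<le> ennreal d + ennreal (A * d + 1 * d)"
        by (intro add_mono) auto
      also have "\<dots> = ennreal (d + (A * d + 1 * d))"
        using d A0 by (intro ennreal_plus[symmetric]) auto
      also have "d + (A * d + 1 * d) = (A + 2) * d"
        by (simp add: algebra_simps)
      also have "\<dots> = e'"
        using A0 by (simp add: d_def)
      finally show "?nZ (\<lambda>x. v x - u x) < e" using e'(2) by (rule order.strict_trans1)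
    qed (use d in auto)
  qed
  moreover have "norm_totally_bounded ?Z ?nZ S" if SY: "S \<subseteq> ?Y" and bdd: "norm_bounded ?nY S" for S
    unfolding norm_totally_bounded_def
  proof (intro conjI allI impI)
    show "S \<subseteq> ?Z" using SY YZ by blast
    fix e :: ennreal assume "0 < e"
    then obtain e' where e': "0 < e'" "ennreal e' < e" by (rule ennreal_pos_real_below)
    obtain c where c: "0 < c" "\<And>u. u \<in> S \<Longrightarrow> ?nY u < ennreal c"
    proof -
      obtain C where C: "C < \<infinity>" "\<And>u. u \<in> S \<Longrightarrow> ?nY u \<le> C"
        using bdd by (auto simp: norm_bounded_def)
      obtain c where "0 < c" "C < ennreal c"
        using C(1) by (rule ennreal_finite_real_above)
      with C(2) show ?thesis by (intro that[of c]) (auto intro: order.strict_trans1)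
    qed
    define Q where "Q = quasi_const l"
    have Q: "0 < Q" by (simp add: Q_def quasi_const_pos)
    \<comment> \<open>The factors \<open>2\<close> turn the quasi-triangle inequalities into strict bounds; one half of \<open>e'\<close> is
      spent on \<open>a + A * a\<close>, the other on the term with \<open>b\<close>.\<close>
    define b where "b = 2 * (Q * c)"
    have b: "0 < b" "Q * c < b" using Q c by (auto simp: b_def)
    obtain A where A0: "0 < A" and A: "\<forall>w a b'. w \<in> borel_measurable \<mu> \<longrightarrow> 0 < a \<longrightarrow> 0 < b' \<longrightarrow>
      Lp_norm \<mu> p w < ennreal a \<longrightarrow> ?S w < ennreal b' \<longrightarrow> sem w \<le> ennreal (A * a + e' / (2 * b) * b')"
      using ehrling[of "e' / (2 * b)"] e' b by auto
    define a where "a = e' / (2 * (A + 1))"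
    have a: "0 < a" using e' A0 by (simp add: a_def)
    define \<eta> where "\<eta> = a / (2 * Q)"
    have \<eta>: "0 < \<eta>" "Q * \<eta> < a" using a Q by (auto simp: \<eta>_def)
    have "norm_totally_bounded (Lp_space \<mu> p) (Lp_norm \<mu> p) S"
      using cpt SY bdd by (auto simp: compact_embedding_def)
    then have "\<exists>F. finite F \<and> F \<subseteq> Lp_space \<mu> p \<and>
        (\<forall>u\<in>S. \<exists>v\<in>F. Lp_norm \<mu> p (\<lambda>x. u x - v x) < ennreal \<eta>)"
      using \<eta>(1) by (simp add: norm_totally_bounded_def)
    then obtain F where F: "finite F" "F \<subseteq> Lp_space \<mu> p"
      and net: "\<And>u. u \<in> S \<Longrightarrow> \<exists>v\<in>F. Lp_norm \<mu> p (\<lambda>x. u x - v x) < ennreal \<eta>"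
      by auto
    define near where "near v u \<longleftrightarrow> u \<in> S \<and> Lp_norm \<mu> p (\<lambda>x. u x - v x) < ennreal \<eta>" for v u
    define rep where "rep v = (SOME u. near v u)" for v
    define F' where "F' = rep ` {v \<in> F. \<exists>u. near v u}"
    have rep: "near v (rep v)" if "near v u" for u v
      using someI[of "near v", OF that] by (simp add: rep_def)
    show "\<exists>F. finite F \<and> F \<subseteq> ?Z \<and> (\<forall>u\<in>S. \<exists>v\<in>F. ?nZ (\<lambda>x. u x - v x) < e)"
    proof (intro exI[of _ F'] conjI ballI)
      show "finite F'" using F by (simp add: F'_def)
      show "F' \<subseteq> ?Z" using rep SY YZ by (auto simp: F'_def near_def)
      fix u assume u: "u \<in> S"
      then obtain v where v: "v \<in> F" "near v u" using net by (auto simp: near_def)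
      define u' where "u' = rep v"
      have u': "near v u'" "u' \<in> F'" using v rep by (auto simp: F'_def u'_def)
      have u'S: "u' \<in> S" using u' by (simp add: near_def)
      have meas: "u \<in> borel_measurable \<mu>" "u' \<in> borel_measurable \<mu>" "v \<in> borel_measurable \<mu>"
        using Y(2) u u'S SY v(1) F(2) by (auto simp: Lp_space_def)
      have "Lp_norm \<mu> p (\<lambda>x. u x - u' x) \<le> ennreal (Q * \<eta>)"
        unfolding Q_def
      proof (rule Lp_norm_quasi_triangle[OF p _ _ \<eta>(1)])
        show "Lp_norm \<mu> p (\<lambda>x. u x - v x) < ennreal \<eta>" "Lp_norm \<mu> p (\<lambda>x. u' x - v x) < ennreal \<eta>"
          using v(2) u'(1) by (auto simp: near_def)
      qed (use meas in \<open>auto intro: diff eabs_diff\<close>)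
      also have "\<dots> < ennreal a" using \<eta> Q by (intro ennreal_lessI) (use a in auto)
      finally have Lp: "Lp_norm \<mu> p (\<lambda>x. u x - u' x) < ennreal a" .
      have "?S (\<lambda>x. u x - u' x) \<le> ennreal (Q * c)"
        unfolding Q_def
        by (rule M_seminorm_infinity_quasi_triangle[OF p c(1)
              order.strict_trans1[OF nY(2) c(2)[OF u]] order.strict_trans1[OF nY(2) c(2)[OF u'S]]])
      also have "\<dots> < ennreal b" using b by (intro ennreal_lessI)
      finally have S: "?S (\<lambda>x. u x - u' x) < ennreal b" .
      have "sem (\<lambda>x. u x - u' x) \<le> ennreal (A * a + e' / (2 * b) * b)"
        by (rule A[rule_format, OF diff[OF meas(1,2)] a b(1) Lp S])
      with Lp have "?nZ (\<lambda>x. u x - u' x) \<le> ennreal a + ennreal (A * a + e' / (2 * b) * b)"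
        by (intro add_mono) auto
      also have "\<dots> = ennreal (a + (A * a + e' / (2 * b) * b))"
        using a A0 b e' by (intro ennreal_plus[symmetric]) auto
      also have "a + (A * a + e' / (2 * b) * b) = (A + 1) * a + e' / 2"
        using b by (simp add: algebra_simps)
      also have "\<dots> = e'"
        using A0 by (simp add: a_def field_simps)
      finally have "?nZ (\<lambda>x. u x - u' x) < e" using e'(2) by (rule order.strict_trans1)
      with u'(2) show "\<exists>v\<in>F'. ?nZ (\<lambda>x. u x - v x) < e" by blast
    qed
  qed
  ultimately show ?thesis
    unfolding compact_embedding_def using YZ by blast
qed

lemma compact_embedding_weaken_target:
  assumes "compact_embedding Y nY Z nZ" "Z \<subseteq> Z'" "\<And>u. nZ' u \<le> nZ u"
  shows "compact_embedding Y nY Z' nZ'"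
proof -
  have less: "nZ' u < e" if "nZ u < e" for u e
    using assms(3) that by (rule order.strict_trans1)
  have "Y \<subseteq> Z'" using assms(1,2) by (auto simp: compact_embedding_def)
  moreover have "continuous_inclusion Y nY nZ'"
    unfolding continuous_inclusion_def
  proof (intro ballI allI impI)
    fix u and e :: ennreal assume "u \<in> Y" "0 < e"
    then obtain d where "0 < d" "\<forall>v\<in>Y. nY (\<lambda>x. v x - u x) < d \<longrightarrow> nZ (\<lambda>x. v x - u x) < e"
      using assms(1) unfolding compact_embedding_def continuous_inclusion_def by blast
    then show "\<exists>d>0. \<forall>v\<in>Y. nY (\<lambda>x. v x - u x) < d \<longrightarrow> nZ' (\<lambda>x. v x - u x) < e"
      using less by (intro exI[of _ d]) blast
  qed
  moreover have "norm_totally_bounded Z' nZ' S" if tb: "norm_totally_bounded Z nZ S" for S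
    unfolding norm_totally_bounded_def
  proof (intro conjI allI impI)
    show "S \<subseteq> Z'" using tb assms(2) by (auto simp: norm_totally_bounded_def)
    fix e :: ennreal assume "0 < e"
    then obtain F where "finite F" "F \<subseteq> Z" "\<forall>u\<in>S. \<exists>v\<in>F. nZ (\<lambda>x. u x - v x) < e"
      using tb unfolding norm_totally_bounded_def by blast
    then show "\<exists>F. finite F \<and> F \<subseteq> Z' \<and> (\<forall>u\<in>S. \<exists>v\<in>F. nZ' (\<lambda>x. u x - v x) < e)"
      using assms(2) less by (intro exI[of _ F]) blast
  qed
  ultimately show ?thesis
    using assms(1) unfolding compact_embedding_def by blast
qed

theorem theorem3p15:
  fixes \<mu> :: "'a::metric_space measure"
    and p q s :: "'a \<Rightarrow> ereal"
  assumes "metric_measure_space \<mu>"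
    and "p \<in> bdd_exponents \<mu>" and "s \<in> bdd_exponents \<mu>" and "q \<in> exponents \<mu>"
  defines "i \<equiv> compact_embedding (M_space \<mu> s p q) (M_norm \<mu> s p q) (Lp_space \<mu> p) (Lp_norm \<mu> p)"
    and "ii \<equiv> \<forall>r\<in>exponents \<mu>. \<forall>t\<in>bdd_exponents \<mu>. exponent_ll \<mu> t s \<longrightarrow>
      compact_embedding (M_space \<mu> s p q) (M_norm \<mu> s p q) (M_space \<mu> t p r) (M_norm \<mu> t p r) \<and>
      compact_embedding (M_space \<mu> s p q) (M_norm \<mu> s p q) (N_space \<mu> t p r) (N_norm \<mu> t p r)"
    and "iii \<equiv> \<exists>r\<in>exponents \<mu>. \<exists>t\<in>bdd_exponents \<mu>. exponent_ll \<mu> t s \<and>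
      (compact_embedding (M_space \<mu> s p q) (M_norm \<mu> s p q) (M_space \<mu> t p r) (M_norm \<mu> t p r) \<or>
       compact_embedding (M_space \<mu> s p q) (M_norm \<mu> s p q) (N_space \<mu> t p r) (N_norm \<mu> t p r))"
  shows "(i \<longleftrightarrow> ii) \<and> (ii \<longleftrightarrow> iii)"
proof -
  have sp: "space \<mu> = UNIV"
    using assms(1) sets_eq_imp_space_eq[of \<mu> borel] by (simp add: metric_measure_space_def)
  obtain l where p: "bounded_below_exponent \<mu> l p"
    using bdd_exponent_bounded_below[OF assms(2)] .
  have q: "0 < q x" for x
    using assms(4) sp by (auto simp: exponents_def)
  have "ii" if i
    unfolding ii_def
  proof (intro ballI impI)
    fix r t assume r: "r \<in> exponents \<mu>" and t: "t \<in> bdd_exponents \<mu>" and ts: "exponent_ll \<mu> t s"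
    have eq: "M_space \<mu> t p r = {u \<in> Lp_space \<mu> p. M_seminorm \<mu> t p r u < \<infinity>}"
      "M_norm \<mu> t p r = (\<lambda>u. Lp_norm \<mu> p u + M_seminorm \<mu> t p r u)"
      "N_space \<mu> t p r = {u \<in> Lp_space \<mu> p. N_seminorm \<mu> t p r u < \<infinity>}"
      "N_norm \<mu> t p r = (\<lambda>u. Lp_norm \<mu> p u + N_seminorm \<mu> t p r u)"
      by (auto simp: M_space_def M_norm_def N_space_def N_norm_def)
    note ehrling = ehrling_inequality[OF sp p assms(3) t ts r]
    note compact = compact_embedding_by_ehrling[OF p q \<open>i\<close>[unfolded i_def]]
    show "compact_embedding (M_space \<mu> s p q) (M_norm \<mu> s p q) (M_space \<mu> t p r) (M_norm \<mu> t p r) \<and>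
      compact_embedding (M_space \<mu> s p q) (M_norm \<mu> s p q) (N_space \<mu> t p r) (N_norm \<mu> t p r)"
      unfolding eq
    proof (intro conjI compact)
      fix e :: real assume "0 < e"
      then obtain A where A: "0 < A"
        "\<And>w a b. w \<in> borel_measurable \<mu> \<Longrightarrow> 0 < a \<Longrightarrow> 0 < b \<Longrightarrow> Lp_norm \<mu> p w < ennreal a \<Longrightarrow>
          M_seminorm \<mu> s p (\<lambda>_. \<infinity>) w < ennreal b \<Longrightarrow>
          M_seminorm \<mu> t p r w \<le> ennreal (A * a + e * b) \<and>
          N_seminorm \<mu> t p r w \<le> ennreal (A * a + e * b)"
        by (rule ehrling) blast
      then show "\<exists>A>0. \<forall>w a b. w \<in> borel_measurable \<mu> \<longrightarrow> 0 < a \<longrightarrow> 0 < b \<longrightarrow>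
          Lp_norm \<mu> p w < ennreal a \<longrightarrow> M_seminorm \<mu> s p (\<lambda>_. \<infinity>) w < ennreal b \<longrightarrow>
          M_seminorm \<mu> t p r w \<le> ennreal (A * a + e * b)"
        and "\<exists>A>0. \<forall>w a b. w \<in> borel_measurable \<mu> \<longrightarrow> 0 < a \<longrightarrow> 0 < b \<longrightarrow>
          Lp_norm \<mu> p w < ennreal a \<longrightarrow> M_seminorm \<mu> s p (\<lambda>_. \<infinity>) w < ennreal b \<longrightarrow>
          N_seminorm \<mu> t p r w \<le> ennreal (A * a + e * b)"
        by (auto intro!: exI[of _ A])
    qed
  qed
  moreover have "iii" if ii
    using that halved_exponent[OF assms(3)] assms(4) unfolding ii_def iii_def by blast
  moreover have "i" if iii: iii
  proof -
    obtain r t where "compact_embedding (M_space \<mu> s p q) (M_norm \<mu> s p q) (M_space \<mu> t p r) (M_norm \<mu> t p r) \<or>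
       compact_embedding (M_space \<mu> s p q) (M_norm \<mu> s p q) (N_space \<mu> t p r) (N_norm \<mu> t p r)"
      using iii unfolding iii_def by blast
    then show i
      unfolding i_def
      by (elim disjE; elim compact_embedding_weaken_target)
        (auto simp: M_space_def M_norm_def N_space_def N_norm_def)
  qed
  ultimately show ?thesis by blast
qed

end
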